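(* Let $0<\alpha\leq 1$. Let $P\in\mathbb{Q}[x]$ be an integer-valued polynomial of degree $r\geq 2$ with positive leading coefficient. Let $a=(a_k)_{k\geq 1}$ be a strictly increasing sequence of positive integers such that $a_k=P(k)$ for all sufficiently large $k$. Then, for every $f\in L^{1}(\mathbb{T})$ and every Lebesgue point $x$ of $f$, $$\sigma_{N,\alpha}^{a}f(x)\longrightarrow f(x)\qquad (N\to\infty).$$
   Context: $\mathbb{T}=\mathbb{R}/(2\pi\mathbb{Z})$. For $f\in L^{1}(\mathbb{T})$, the Fourier coefficients are $\widehat{f}(m):=\frac{1}{2\pi}\int_{-\pi}^{\pi}f(x)e^{-imx}\,dx$ for $m\in\mathbb{Z}$, and the partial sums are $S_nf(x):=\sum_{|m|\leq n}\widehat{f}(m)e^{imx}$ for $n=0,1,2,\ldots$. For $\beta>-1$ put $A_n^\beta:=\binom{n+\beta}{n}$ (generalized binomial coefficient, $A_n^\beta=\prod_{i=1}^{n}\frac{\beta+i}{i}$), $n=0,1,2,\ldots$. For $0<\alpha\leq 1$ and a strictly increasing sequence $a=(a_k)_{k\geq 1}$ of positive integers, the $(C,\alpha)$ means are $$\sigma_{N,\alpha}^{a}f(x):=\frac{1}{A_{N-1}^{\alpha}}\sum_{k=1}^{N}A_{N-k}^{\alpha-1}S_{a_k}f(x),\qquad N\geq 1.$$ A point $x\in\mathbb{T}$ is a Lebesgue point of $f\in L^{1}(\mathbb{T})$ if $\int_{-h}^{h}|f(x+t)-f(x)|\,dt=o(h)$ as $h\downarrow 0$. A polynomial $P\in\mathbb{Q}[x]$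 is integer-valued if $P(n)\in\mathbb{Z}$ for every $n\in\mathbb{Z}$. *)

theory Defs
  imports
    "HOL-Analysis.Analysis"
    "HOL-Computational_Algebra.Polynomial"
    "HOL-Library.Landau_Symbols"
begin

text \<open>
  Functions on the circle \<open>\<real> / 2\<pi>\<int>\<close> are represented by \<open>2\<pi>\<close>-periodic functions on the real line.
  A function of class \<open>L\<^sup>1\<close> is given by an everywhere defined, Lebesgue measurable representative,
  so that the values \<open>f x\<close> at individual points are meaningful.
\<close>

definition L1_circle :: "(real \<Rightarrow> complex) \<Rightarrow> bool" where
  "L1_circle f \<longleftrightarrow>
     (\<forall>x. f (x + 2 * pi) = f x) \<and> set_integrable lebesgue {-pi..pi} f"

definition fourier_coeff :: "(real \<Rightarrow> complex) \<Rightarrow> int \<Rightarrow> complex" where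
  "fourier_coeff f m =
     1 / (2 * of_real pi) *
     (LINT x:{-pi..pi}|lebesgue. f x * exp (- \<i> * of_int m * of_real x))"

definition fourier_partial_sum :: "nat \<Rightarrow> (real \<Rightarrow> complex) \<Rightarrow> real \<Rightarrow> complex" where
  "fourier_partial_sum n f x =
     (\<Sum>m = - int n..int n. fourier_coeff f m * exp (\<i> * of_int m * of_real x))"

definition cesaro_number :: "real \<Rightarrow> nat \<Rightarrow> real" where
  "cesaro_number \<beta> n = (real n + \<beta>) gchoose n"

lemma cesaro_number_eq_prod:
  "cesaro_number \<beta> n = (\<Prod>i = 1..n. (\<beta> + real i) / real i)"
proof -
  have "cesaro_number \<beta> n = pochhammer (\<beta> + 1) n / fact n"
    by (simp add: cesaro_number_def gbinomial_pochhammer')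
  also have "\<dots> = (\<Prod>i = 1..n. (\<beta> + real i) / real i)"
    by (simp add: pochhammer_prod fact_prod prod_dividef prod.atLeast1_atMost_eq lessThan_atLeast0
        algebra_simps)
  finally show ?thesis .
qed

text \<open>
  The sequence \<open>a\<close> is indexed from \<open>1\<close>; its value at \<open>0\<close> is never used.
  The means are meant for \<open>N \<ge> 1\<close>.
\<close>

definition cesaro_mean ::
  "real \<Rightarrow> (nat \<Rightarrow> nat) \<Rightarrow> nat \<Rightarrow> (real \<Rightarrow> complex) \<Rightarrow> real \<Rightarrow> complex" where
  "cesaro_mean \<alpha> a N f x =
     1 / of_real (cesaro_number \<alpha> (N - 1)) *
     (\<Sum>k = 1..N. of_real (cesaro_number (\<alpha> - 1) (N - k)) * fourier_partial_sum (a k) f x)"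

definition lebesgue_point :: "(real \<Rightarrow> complex) \<Rightarrow> real \<Rightarrow> bool" where
  "lebesgue_point f x \<longleftrightarrow>
     (\<lambda>h. LINT t:{-h..h}|lebesgue. norm (f (x + t) - f x)) \<in> o[at_right 0](\<lambda>h. h)"

definition integer_valued :: "rat poly \<Rightarrow> bool" where
  "integer_valued P \<longleftrightarrow> (\<forall>n::int. poly P (of_int n) \<in> \<int>)"

end

theory Submission
  imports Defs
begin

text \<open>
  The kernel \<open>K\<^sub>N\<close> of the means is bounded by \<open>O(N\<^sup>r)\<close> and, away from \<open>0\<close>, by \<open>\<pi> |W\<^sub>N(t)| / |t|\<close>
  with the weighted Weyl sum \<open>W\<^sub>N(t) = \<Sum>\<^sub>k \<lambda>\<^sub>k e\<^bsup>i a\<^sub>k t\<^esup>\<close>.  Van der Corput differencing, with the length of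
  the shifts adapted to \<open>t\<close> so that the final linear phase stays in \<open>(0, \<pi>]\<close>, gives the uniform bound
  \<open>|W\<^sub>N(t)| \<le> C (t\<^sup>c + (N\<^sup>r t)\<^bsup>-c\<^esup>)\<close> for \<open>t \<ge> N\<^bsup>-r\<^esup>\<close>; no major arcs other than the one at \<open>0\<close> enter,
  because a nonzero rational near \<open>0\<close> has a large denominator, and this is where \<open>r \<ge> 2\<close> is needed.
  So near \<open>0\<close> the kernel has a radially decreasing integrable majorant, and a Lebesgue point suffices there.
  At a fixed distance from \<open>0\<close> the peaks at rational multiples of \<open>2\<pi>\<close> do not matter either:
  \<open>W\<^sub>N(t) \<rightarrow> 0\<close> for irrational \<open>t / (2\<pi>)\<close> by Weyl equidistribution, and dominated convergence applies.
\<close>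

section \<open>Van der Corput differencing\<close>

text \<open>A Lebesgue point controls |f(x + t) - f(x)| only in the mean over intervals centred at
  x, so near 0 decay of the kernel at each fixed t does not help: a majorant whose integral stays
  bounded in N is needed. Dividing the bound for W_N by t gives t^(c-1), integrable at 0, and t^(-1)
  (N^r t)^(-c), whose integral over t \<ge> N^(-r) is bounded by scaling. Hence any c > 0 is enough,
  and the exponent may be spent freely: a square root at each differencing, and a factor \<alpha>
  for the Cesaro weights.

  For \<alpha> < 1 these weights grow towards k = N, and Abel summation over the whole range would
  pay the largest of them, which loses too much. If the unweighted sums are at most B N, a final
  block of about B N terms carries a share of order B^\<alpha> of the total weight; it is bounded
  trivially, and Abel summation on the rest costs no more. Abel summation calls for all partial
  sums, so the Weyl bounds cover every length n \<le> N with one normalisation by N.\<close>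

lemma van_der_Corput_inequality:
  fixes u :: "nat \<Rightarrow> complex"
  assumes H: "1 \<le> H" and u: "\<And>k. norm (u k) \<le> 1"
  shows "(norm (\<Sum>k<n. u k))\<^sup>2 \<le>
    real (n + H) / real H * (real n + 2 * (\<Sum>d = 1..<H. norm (\<Sum>k<n - d. u (k + d) * cnj (u k))))"
proof -
  \<comment> \<open>\<open>w\<close> is \<open>u\<close> delayed by H and padded with zeros. Every
    shift by h < H then keeps the whole support inside m < n + H, and no negative index
    arises.\<close>
  define w where "w k = (if H \<le> k \<and> k < n + H then u (k - H) else 0)" for k
  define c where "c d = norm (\<Sum>k<n - d. u (k + d) * cnj (u k))" for d
  have shift: "(\<Sum>m<n + H. w (m + h)) = (\<Sum>k<n. u k)" if "h < H" for h
  proof -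
    have "(\<Sum>k<n. u k) = (\<Sum>m\<in>{H - h..<n + H - h}. w (m + h))"
      by (rule sum.reindex_bij_witness[where i="\<lambda>m. m + h - H" and j="\<lambda>k. k + H - h"])
         (use that in \<open>auto simp: w_def\<close>)
    also have "\<dots> = (\<Sum>m<n + H. w (m + h))"
      by (rule sum.mono_neutral_left) (use that in \<open>auto simp: w_def\<close>)
    finally show ?thesis by simp
  qed
  have corr: "(\<Sum>m<n + H. w (m + h) * cnj (w (m + h'))) = (\<Sum>k<n - (h - h'). u (k + (h - h')) * cnj (u k))"
    if "h' \<le> h" "h < H" for h h'
  proof -
    have "(\<Sum>k<n - (h - h'). u (k + (h - h')) * cnj (u k))
        = (\<Sum>m\<in>{H - h'..<n + H - h}. w (m + h) * cnj (w (m + h')))"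
      by (rule sum.reindex_bij_witness[where i="\<lambda>m. m + h' - H" and j="\<lambda>k. k + H - h'"])
         (use that in \<open>auto simp: w_def algebra_simps\<close>)
    also have "\<dots> = (\<Sum>m<n + H. w (m + h) * cnj (w (m + h')))"
      by (rule sum.mono_neutral_left) (use that in \<open>auto simp: w_def\<close>)
    finally show ?thesis by simp
  qed
  have corr_norm: "norm (\<Sum>m<n + H. w (m + h) * cnj (w (m + h'))) \<le> c (if h' \<le> h then h - h' else h' - h)"
    if "h < H" "h' < H" for h h'
  proof (cases "h' \<le> h")
    case True
    then show ?thesis using corr[OF True \<open>h < H\<close>] by (simp add: c_def)
  next
    case False
    have "(\<Sum>m<n + H. w (m + h) * cnj (w (m + h'))) = cnj (\<Sum>m<n + H. w (m + h') * cnj (w (m + h)))"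
      by (simp add: mult.commute)
    also have "norm \<dots> = c (h' - h)"
      unfolding complex_mod_cnj c_def using corr[of h h'] False that by simp
    finally show ?thesis using False by simp
  qed
  \<comment> \<open>For fixed h each positive lag occurs at most twice, once on either side of
    h.\<close>
  have row: "(\<Sum>h'<H. c (if h' \<le> h then h - h' else h' - h)) \<le> c 0 + 2 * (\<Sum>d = 1..<H. c d)"
    if "h < H" for h
  proof -
    have c0: "c d \<ge> 0" for d by (simp add: c_def)
    have split: "{..<H} = {..<h} \<union> {h} \<union> {h<..<H}" using that by auto
    have "(\<Sum>h'<H. c (if h' \<le> h then h - h' else h' - h))
        = (\<Sum>h'<h. c (h - h')) + c 0 + (\<Sum>h'\<in>{h<..<H}. c (h' - h))"
      unfolding split by (subst sum.union_disjoint, auto)+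
    also have "(\<Sum>h'<h. c (h - h')) = (\<Sum>d\<in>{1..h}. c d)"
      by (rule sum.reindex_bij_witness[where i="\<lambda>d. h - d" and j="\<lambda>d. h - d"]) auto
    also have "\<dots> \<le> (\<Sum>d = 1..<H. c d)"
      by (rule sum_mono2) (use that c0 in auto)
    also have "(\<Sum>h'\<in>{h<..<H}. c (h' - h)) = (\<Sum>d\<in>{1..<H - h}. c d)"
      by (rule sum.reindex_bij_witness[where i="\<lambda>d. h + d" and j="\<lambda>d. d - h"]) auto
    also have "\<dots> \<le> (\<Sum>d = 1..<H. c d)"
      by (rule sum_mono2) (use that c0 in auto)
    finally show ?thesis by simp
  qed
  have c0: "c 0 \<le> real n"
  proof -
    have "c 0 \<le> (\<Sum>k<n. norm (u k * cnj (u k)))" unfolding c_def by (simp add: norm_sum)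
    also have "\<dots> \<le> (\<Sum>k<n. 1)"
      by (intro sum_mono) (use u in \<open>auto simp: norm_mult intro!: mult_le_one\<close>)
    finally show ?thesis by simp
  qed
  \<comment> \<open>H copies of the sum, one for each shift, are regrouped into n + H windows of
    length at most H; Cauchy-Schwarz over the windows and expansion of the squares leave only
    correlations.\<close>
  have "(real H * norm (\<Sum>k<n. u k))\<^sup>2 = (norm (\<Sum>h<H. \<Sum>m<n + H. w (m + h)))\<^sup>2"
    by (simp add: shift norm_mult)
  also have "\<dots> = (norm (\<Sum>m<n + H. \<Sum>h<H. w (m + h)))\<^sup>2"
    by (subst sum.swap) simp
  also have "\<dots> \<le> (\<Sum>m<n + H. norm (\<Sum>h<H. w (m + h)))\<^sup>2"
    by (intro power_mono norm_sum) auto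
  also have "\<dots> \<le> (\<Sum>m<n + H. (1::real)\<^sup>2) * (\<Sum>m<n + H. (norm (\<Sum>h<H. w (m + h)))\<^sup>2)"
    using Cauchy_Schwarz_ineq_sum[of "\<lambda>_. 1" "\<lambda>m. norm (\<Sum>h<H. w (m + h))" "{..<n + H}"] by simp
  also have "\<dots> = real (n + H) * (\<Sum>m<n + H. (norm (\<Sum>h<H. w (m + h)))\<^sup>2)"
    by simp
  also have "(\<Sum>m<n + H. (norm (\<Sum>h<H. w (m + h)))\<^sup>2)
      = norm (\<Sum>m<n + H. (\<Sum>h<H. w (m + h)) * cnj (\<Sum>h<H. w (m + h)))"
  proof -
    have "(\<Sum>m<n + H. (\<Sum>h<H. w (m + h)) * cnj (\<Sum>h<H. w (m + h)))
        = of_real (\<Sum>m<n + H. (norm (\<Sum>h<H. w (m + h)))\<^sup>2)"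
      unfolding of_real_sum by (intro sum.cong refl complex_norm_square[symmetric])
    then show ?thesis by (simp add: sum_nonneg del: of_real_sum)
  qed
  also have "(\<Sum>m<n + H. (\<Sum>h<H. w (m + h)) * cnj (\<Sum>h<H. w (m + h)))
      = (\<Sum>m<n + H. \<Sum>h<H. \<Sum>h'<H. w (m + h) * cnj (w (m + h')))"
    by (simp add: sum_product)
  also have "\<dots> = (\<Sum>h<H. \<Sum>m<n + H. \<Sum>h'<H. w (m + h) * cnj (w (m + h')))"
    by (rule sum.swap)
  also have "\<dots> = (\<Sum>h<H. \<Sum>h'<H. \<Sum>m<n + H. w (m + h) * cnj (w (m + h')))"
    by (intro sum.cong refl sum.swap)
  also have "norm \<dots> \<le> (\<Sum>h<H. \<Sum>h'<H. c (if h' \<le> h then h - h' else h' - h))"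
    by (intro sum_norm_le corr_norm) auto
  also have "\<dots> \<le> (\<Sum>h<H. real n + 2 * (\<Sum>d = 1..<H. c d))"
    using order_trans[OF row add_right_mono[OF c0]] by (intro sum_mono) auto
  also have "\<dots> = real H * (real n + 2 * (\<Sum>d = 1..<H. c d))" by simp
  finally have "(real H)\<^sup>2 * (norm (\<Sum>k<n. u k))\<^sup>2
      \<le> real (n + H) * (real H * (real n + 2 * (\<Sum>d = 1..<H. c d)))"
    by (simp only: power_mult_distrib mult_left_mono[OF _ of_nat_0_le_iff])
  then have "real H * (real H * (norm (\<Sum>k<n. u k))\<^sup>2)
      \<le> real H * (real (n + H) * (real n + 2 * (\<Sum>d = 1..<H. c d)))"
    by (simp only: power2_eq_square mult_ac)
  then have "real H * (norm (\<Sum>k<n. u k))\<^sup>2 \<le> real (n + H) * (real n + 2 * (\<Sum>d = 1..<H. c d))"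
    using H by (subst (asm) mult_le_cancel_left_pos) auto
  then show ?thesis using H unfolding c_def
    by (simp add: le_divide_eq mult_ac)
qed

text \<open>Induction along x p + a: its difference is h (p + q) + x q, where q is the difference of
  p. An upper bound for the degree, with a possibly vanishing top coefficient, is the form that
  survives this induction and needs no separate treatment of degree drops.\<close>

lemma difference_poly:
  fixes p :: "'a::comm_ring_1 poly"
  shows "degree p \<le> Suc d \<Longrightarrow> degree (pcompose p [:h, 1:] - p) \<le> d \<and>
    coeff (pcompose p [:h, 1:] - p) d = of_nat (Suc d) * h * coeff p (Suc d)"
proof (induction p arbitrary: d)
  case 0
  then show ?case by simp
next
  case (pCons a p)
  define q where "q = pcompose p [:h, 1:] - p"
  have eq: "pcompose (pCons a p) [:h, 1:] - pCons a p = smult h (p + q) + pCons 0 q"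
    by (simp add: pcompose_pCons q_def algebra_simps smult_add_right smult_diff_right)
  show ?case
  proof (cases d)
    case 0
    then have "degree p = 0" using pCons.prems pCons.hyps by (auto split: if_splits)
    then have "q = 0" unfolding q_def by (auto elim: degree_eq_zeroE)
    then show ?thesis unfolding eq 0 using \<open>degree p = 0\<close> by (auto elim: degree_eq_zeroE)
  next
    case (Suc e)
    then have "degree p \<le> Suc e" using pCons.prems by (auto split: if_splits)
    then have IH: "degree q \<le> e" "coeff q e = of_nat (Suc e) * h * coeff p (Suc e)"
      using pCons.IH[of e] unfolding q_def by auto
    have "degree (smult h (p + q)) \<le> d"
      using \<open>degree p \<le> Suc e\<close> IH(1) Suc
      by (intro order_trans[OF degree_smult_le] degree_add_le) auto
    moreover have "degree (pCons 0 q) \<le> d" using IH(1) Suc by simp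
    moreover have "coeff q d = 0" using IH(1) Suc by (intro coeff_eq_0) auto
    ultimately show ?thesis unfolding eq
      using IH(2) Suc by (auto intro!: degree_add_le simp: algebra_simps)
  qed
qed

section \<open>Weyl sums\<close>

text \<open>Jordan's inequality: a concave function lies above its chord, here the one from 0 to pi
  / 2.\<close>

lemma sin_ge_linear:
  assumes "0 \<le> x" and "x \<le> pi / 2"
  shows "2 * x / pi \<le> sin x"
proof -
  have "concave_on {0..pi} sin"
    by (rule f''_le0_imp_concave[where f' = cos and f'' = "\<lambda>x. - sin x"])
       (auto intro!: derivative_eq_intros sin_ge_zero)
  from concave_onD[OF this, of "2 * x / pi" 0 "pi / 2"] assms
  show ?thesis by (simp add: field_simps)
qed

lemma norm_sum_geometric_le:
  fixes z :: complex
  assumes "norm z = 1" and "z \<noteq> 1"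
  shows "norm (\<Sum>k<n. z ^ k) \<le> 2 / norm (z - 1)"
proof -
  have "norm (z ^ n - 1) \<le> 2"
    using norm_triangle_ineq4[of "z ^ n" 1] assms by (simp add: norm_power)
  then show ?thesis
    using assms by (simp add: geometric_sum norm_divide divide_right_mono)
qed

lemma norm_sum_cis_linear_le:
  assumes "cis \<beta> \<noteq> 1"
  shows "norm (\<Sum>k<n. cis (\<gamma> + \<beta> * real k)) \<le> 2 / norm (cis \<beta> - 1)"
proof -
  have "(\<Sum>k<n. cis (\<gamma> + \<beta> * real k)) = cis \<gamma> * (\<Sum>k<n. cis \<beta> ^ k)"
    by (simp add: sum_distrib_left cis_mult Complex.DeMoivre mult.commute)
  then show ?thesis
    using norm_sum_geometric_le[of "cis \<beta>" n] assms by (simp add: norm_mult)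
qed

lemma norm_sum_cis_le: "norm (\<Sum>k<n. cis (q k)) \<le> real n"
  using norm_sum[of "\<lambda>k. cis (q k)" "{..<n}"] by simp

lemma poly_degree_le_1:
  fixes p :: "real poly"
  assumes "degree p \<le> Suc 0"
  shows "poly p x = coeff p 0 + coeff p (Suc 0) * x"
proof -
  from assms obtain a b where "p = [:a, b:]"
    by (cases p rule: pCons_cases; cases "degree p") (auto split: if_splits elim: degree_eq_zeroE)
  then show ?thesis by simp
qed

text \<open>Comparison with the extreme exponent 1 / 2, for which the terms are dominated by a
  telescoping difference of square roots; this gives a constant independent of \<kappa>.\<close>

lemma sum_powr_neg_le:
  assumes "\<kappa> \<le> 1 / 2"
  shows "(\<Sum>d = 1..<H. real d powr - \<kappa>) \<le> 2 * real H powr (1 - \<kappa>)"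
proof (cases "H = 0")
  case False
  have sqrt_sum: "(\<Sum>d = 1..m. 1 / sqrt (real d)) \<le> 2 * sqrt (real m)" for m
  proof (induction m)
    case (Suc m)
    have "1 / sqrt (real (Suc m)) \<le> 2 * (sqrt (real (Suc m)) - sqrt (real m))"
    proof -
      define a b where "a = sqrt (real (Suc m))" and "b = sqrt (real m)"
      have ab: "a > 0" "0 \<le> b" "b \<le> a" "a * a - b * b = 1"
        by (auto simp: a_def b_def)
      have "1 = (a - b) * (a + b)" using ab(4) by (simp add: algebra_simps)
      also have "\<dots> \<le> (a - b) * (2 * a)" using ab by (intro mult_left_mono) auto
      finally show ?thesis using ab(1) unfolding a_def[symmetric] b_def[symmetric]
        by (simp add: divide_le_eq mult_ac)
    qed
    then show ?case using Suc by simp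
  qed simp
  have "(\<Sum>d = 1..<H. real d powr - \<kappa>)
      \<le> (\<Sum>d = 1..<H. real H powr (1 / 2 - \<kappa>) * (1 / sqrt (real d)))"
  proof (intro sum_mono)
    fix d assume d: "d \<in> {1..<H}"
    have "real d powr - \<kappa> = real d powr (1 / 2 - \<kappa>) * real d powr (- (1 / 2))"
      by (simp flip: powr_add)
    also have "real d powr (- (1 / 2)) = 1 / sqrt (real d)"
      by (simp add: powr_minus powr_half_sqrt field_simps)
    also have "real d powr (1 / 2 - \<kappa>) \<le> real H powr (1 / 2 - \<kappa>)"
      using d assms by (intro powr_mono2) auto
    finally show "real d powr - \<kappa> \<le> real H powr (1 / 2 - \<kappa>) * (1 / sqrt (real d))"
      by (simp add: divide_right_mono)
  qed
  also have "\<dots> = real H powr (1 / 2 - \<kappa>) * (\<Sum>d = 1..<H. 1 / sqrt (real d))"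
    by (simp add: sum_distrib_left)
  also have "\<dots> \<le> real H powr (1 / 2 - \<kappa>) * (2 * sqrt (real H))"
    by (intro mult_left_mono order_trans[OF sum_mono2 sqrt_sum]) auto
  also have "\<dots> = 2 * real H powr (1 - \<kappa>)"
    using False by (simp add: powr_half_sqrt[symmetric] powr_add[symmetric])
  finally show ?thesis .
qed simp

text \<open>The reason why differencing iterates: a correlation of polynomial phases is again a
  polynomial phase, with the difference polynomial as exponent.\<close>

lemma cis_poly_correlation:
  "cis (poly p (real (k + h))) * cnj (cis (poly p (real k)))
    = cis (poly (pcompose p [:real h, 1:] - p) (real k))"
  by (simp add: poly_pcompose cis_mult cis_cnj add.commute)

text \<open>The division is by N instead of n, so that the shortened sums of length n - d are
  measured on the same scale and an induction hypothesis for all lengths up to N applies to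
  them.\<close>

lemma weyl_sum_step:
  assumes "1 \<le> H" and "H \<le> N" and "n \<le> N"
  shows "(norm (\<Sum>k<n. cis (poly p (real k))) / real N)\<^sup>2 \<le>
    2 / real H * (1 + 2 * (\<Sum>d = 1..<H.
      norm (\<Sum>k<n - d. cis (poly (pcompose p [:real d, 1:] - p) (real k))) / real N))"
proof -
  define c where "c d = norm (\<Sum>k<n - d. cis (poly (pcompose p [:real d, 1:] - p) (real k)))" for d
  have c0: "0 \<le> (\<Sum>d = 1..<H. c d)" by (intro sum_nonneg) (simp add: c_def)
  have N: "real N > 0" using assms by simp
  have "(norm (\<Sum>k<n. cis (poly p (real k))))\<^sup>2
      \<le> real (n + H) / real H * (real n + 2 * (\<Sum>d = 1..<H. c d))"
    using van_der_Corput_inequality[OF assms(1), of "\<lambda>k. cis (poly p (real k))" n]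
    unfolding cis_poly_correlation c_def by simp
  also have "\<dots> \<le> (2 * real N) / real H * (real N + 2 * (\<Sum>d = 1..<H. c d))"
    using assms c0 by (intro mult_mono divide_right_mono) auto
  also have "\<dots> = (2 / real H * (1 + 2 * ((\<Sum>d = 1..<H. c d) / real N))) * (real N)\<^sup>2"
  proof -
    have "real N + 2 * (\<Sum>d = 1..<H. c d) = (1 + 2 * ((\<Sum>d = 1..<H. c d) / real N)) * real N"
      using N by (simp add: field_simps)
    then show ?thesis by (simp only: power2_eq_square mult_ac times_divide_eq_left times_divide_eq_right)
  qed
  also have "(\<Sum>d = 1..<H. c d) / real N = (\<Sum>d = 1..<H. c d / real N)"
    by (rule sum_divide_distrib)
  finally show ?thesis
    unfolding c_def using N by (simp add: power_divide divide_le_eq)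
qed

text \<open>After s differencings with shifts d_1, ..., d_s < H the phase is linear with slope (s +
  1)! \<open>coeff p (Suc s)\<close> d_1 ... d_s. The premise with pi keeps this slope in (0, pi],
  where the geometric sum is at most pi / slope, so no Diophantine approximation is involved. Each
  differencing takes a square root, whence the exponent 1 / 2^(s+1). The constant depends on s
  alone, so the bound may be applied to t p uniformly in t.\<close>

lemma weyl_sum_bound:
  "\<exists>C\<ge>1. \<forall>p H N n. degree p \<le> Suc s \<longrightarrow> coeff p (Suc s) > 0 \<longrightarrow>
     fact (Suc s) * coeff p (Suc s) * real H ^ s \<le> pi \<longrightarrow> 1 \<le> H \<longrightarrow> H \<le> N \<longrightarrow> n \<le> N \<longrightarrow>
     norm (\<Sum>k<n. cis (poly p (real k))) / real N
       \<le> C * (real H powr - (1 / 2 ^ Suc s) +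
              (real N * coeff p (Suc s) * real H ^ s) powr - (1 / 2 ^ Suc s))"
proof (induction s)
  case 0
  show ?case
  proof (intro exI[of _ "sqrt pi"] conjI allI impI)
    show "1 \<le> sqrt pi" using pi_ge_two by simp
    fix p :: "real poly" and H N n
    define \<beta> where "\<beta> = coeff p (Suc 0)"
    assume p: "degree p \<le> Suc 0" "0 < coeff p (Suc 0)"
      "fact (Suc 0) * coeff p (Suc 0) * real H ^ 0 \<le> pi" and H: "1 \<le> H" "H \<le> N" "n \<le> N"
    have \<beta>: "0 < \<beta>" "\<beta> \<le> pi" and N: "real N > 0" using p H by (auto simp: \<beta>_def)
    define x where "x = norm (\<Sum>k<n. cis (poly p (real k))) / real N"
    have sn: "sin (\<beta> / 2) \<ge> \<beta> / pi"
      using sin_ge_linear[of "\<beta> / 2"] \<beta> by simp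
    have nb: "norm (cis \<beta> - 1) = 2 * sin (\<beta> / 2)"
      using dist_exp_i_1[of \<beta>] \<beta> by (simp add: cis_conv_exp sin_ge_zero)
    have "norm (\<Sum>k<n. cis (poly p (real k))) \<le> 2 / norm (cis \<beta> - 1)"
    proof -
      have "cis \<beta> \<noteq> 1" using nb sn divide_pos_pos[OF \<beta>(1) pi_gt_zero] by force
      then show ?thesis
        using norm_sum_cis_linear_le[of \<beta> "coeff p 0" n]
        unfolding poly_degree_le_1[OF p(1)] \<beta>_def by blast
    qed
    also have "\<dots> \<le> 2 / (2 * (\<beta> / pi))"
      unfolding nb using sn \<beta> less_le_trans[OF divide_pos_pos[OF \<beta>(1) pi_gt_zero] sn]
      by (intro divide_left_mono mult_pos_pos) auto
    finally have "x \<le> pi / (real N * \<beta>)"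
      unfolding x_def using N \<beta> by (simp add: field_simps)
    moreover have "x \<le> 1" "0 \<le> x"
      using norm_sum_cis_le[of "\<lambda>k. poly p (real k)" n] H N by (auto simp: x_def)
    \<comment> \<open>Since x \<le> 1, the bound for x also bounds x^2. Lowering the exponent from 1
      to 1 / 2 at once keeps \<kappa> \<le> 1 / 2 in the induction step; with \<kappa> = 1 the sum
      of d^(-\<kappa>) would produce a logarithm.\<close>
    ultimately have "x\<^sup>2 \<le> pi / (real N * \<beta>)"
      by (smt (verit) mult_left_le power2_eq_square)
    then have "x \<le> sqrt (pi / (real N * \<beta>))"
      by (rule real_le_rsqrt)
    also have "\<dots> = sqrt pi * (real N * \<beta>) powr - (1 / 2)"
    proof -
      have "(real N * \<beta>) powr - (1 / 2) = 1 / sqrt (real N * \<beta>)"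
        unfolding powr_minus_divide using N \<beta> by (subst powr_half_sqrt) auto
      then show ?thesis by (simp only: real_sqrt_divide times_divide_eq_right mult_1_right)
    qed
    also have "\<dots> \<le> sqrt pi * (real H powr - (1 / 2) + (real N * \<beta>) powr - (1 / 2))"
      by (intro mult_left_mono) auto
    finally show "norm (\<Sum>k<n. cis (poly p (real k))) / real N
       \<le> sqrt pi * (real H powr - (1 / 2 ^ Suc 0) +
              (real N * coeff p (Suc 0) * real H ^ 0) powr - (1 / 2 ^ Suc 0))"
      unfolding x_def \<beta>_def by simp
  qed
next
  case (Suc s)
  define \<kappa> :: real where "\<kappa> = 1 / 2 ^ Suc s"
  have \<kappa>: "0 < \<kappa>" "\<kappa> \<le> 1 / 2" "1 / 2 ^ Suc (Suc s) = \<kappa> / 2"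
    by (auto simp: \<kappa>_def field_simps)
  from Suc.IH obtain C where C: "C \<ge> 1" and IH: "\<And>p H N n. degree p \<le> Suc s \<Longrightarrow> coeff p (Suc s) > 0 \<Longrightarrow>
     fact (Suc s) * coeff p (Suc s) * real H ^ s \<le> pi \<Longrightarrow> 1 \<le> H \<Longrightarrow> H \<le> N \<Longrightarrow> n \<le> N \<Longrightarrow>
     norm (\<Sum>k<n. cis (poly p (real k))) / real N
       \<le> C * (real H powr - \<kappa> + (real N * coeff p (Suc s) * real H ^ s) powr - \<kappa>)"
    unfolding \<kappa>_def by blast
  show ?case unfolding \<kappa>(3)
  \<comment> \<open>The diagonal term contributes 2, the two parts of the bound for the correlations
    4 C and 8 C. The concluding square root costs nothing more, because 2 + 8 C is at most its own
    square.\<close>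
  proof (intro exI[of _ "2 + 8 * C"] conjI allI impI)
    show "1 \<le> 2 + 8 * C" using C by simp
    fix p :: "real poly" and H N n
    define \<beta> where "\<beta> = coeff p (Suc (Suc s))"
    assume p: "degree p \<le> Suc (Suc s)" "0 < coeff p (Suc (Suc s))"
      "fact (Suc (Suc s)) * coeff p (Suc (Suc s)) * real H ^ Suc s \<le> pi"
      and H: "1 \<le> H" "H \<le> N" "n \<le> N"
    define x where "x = norm (\<Sum>k<n. cis (poly p (real k))) / real N"
    define X where "X = real N * \<beta> * real H ^ s"
    have pos: "\<beta> > 0" "X > 0" "real H > 0" using p H by (auto simp: \<beta>_def X_def)
    define c where "c d = norm (\<Sum>k<n - d. cis (poly (pcompose p [:real d, 1:] - p) (real k))) / real N" for d
    have cd: "c d \<le> C * (real H powr - \<kappa> + X powr - \<kappa> * real d powr - \<kappa>)" if d: "d \<in> {1..<H}" for d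
    proof -
      let ?q = "pcompose p [:real d, 1:] - p"
      have q: "degree ?q \<le> Suc s" "coeff ?q (Suc s) = of_nat (Suc (Suc s)) * real d * \<beta>"
        using difference_poly[OF p(1), of "real d"] by (auto simp: \<beta>_def)
      \<comment> \<open>A single H serves all levels: the shift d < H takes the place of one factor
        H in the premise, and the degree s + 2 completes the factorial.\<close>
      have "fact (Suc s) * coeff ?q (Suc s) * real H ^ s = fact (Suc (Suc s)) * \<beta> * (real d * real H ^ s)"
        unfolding q(2) by (simp add: algebra_simps)
      also have "\<dots> \<le> fact (Suc (Suc s)) * \<beta> * (real H * real H ^ s)"
        using d pos by (intro mult_left_mono mult_right_mono) auto
      also have "\<dots> \<le> pi" using p(3) by (simp add: \<beta>_def)
      finally have "c d \<le> C * (real H powr - \<kappa> + (real N * coeff ?q (Suc s) * real H ^ s) powr - \<kappa>)"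
        unfolding c_def using d pos H q by (intro IH) auto
      also have "(real N * coeff ?q (Suc s) * real H ^ s) powr - \<kappa> \<le> (X * real d) powr - \<kappa>"
      proof (rule powr_mono2')
        have "X * real d * 1 \<le> X * real d * real (Suc (Suc s))"
          using pos d by (intro mult_left_mono) auto
        then show "X * real d \<le> real N * coeff ?q (Suc s) * real H ^ s"
          unfolding q(2) X_def by (simp add: algebra_simps)
      qed (use pos d \<kappa> in auto)
      finally show ?thesis using C pos by (simp add: powr_mult)
    qed
    have "x\<^sup>2 \<le> 2 / real H * (1 + 2 * (\<Sum>d = 1..<H. c d))"
      unfolding x_def c_def by (rule weyl_sum_step[OF H])
    also have "(\<Sum>d = 1..<H. c d) \<le> (\<Sum>d = 1..<H. C * (real H powr - \<kappa> + X powr - \<kappa> * real d powr - \<kappa>))"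
      by (intro sum_mono cd)
    also have "\<dots> = C * (real (H - 1) * real H powr - \<kappa> + X powr - \<kappa> * (\<Sum>d = 1..<H. real d powr - \<kappa>))"
      by (simp add: sum_distrib_left sum.distrib distrib_left)
    also have "\<dots> \<le> C * (real H * real H powr - \<kappa> + X powr - \<kappa> * (2 * real H powr (1 - \<kappa>)))"
      using C by (intro mult_left_mono add_mono mult_right_mono sum_powr_neg_le \<kappa>) auto
    also have "real H powr (1 - \<kappa>) = real H * real H powr - \<kappa>"
      using pos by (simp add: powr_diff powr_minus divide_inverse)
    finally have "x\<^sup>2 \<le> 2 / real H * (1 + 2 * (C * (real H * real H powr - \<kappa> +
        X powr - \<kappa> * (2 * (real H * real H powr - \<kappa>)))))"
      using pos by (simp add: divide_right_mono)
    also have "\<dots> = 2 / real H + 4 * C * (real H powr - \<kappa>) + 8 * C * (X powr - \<kappa> * real H powr - \<kappa>)"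
      using pos by (simp add: field_simps)
    also have "X powr - \<kappa> * real H powr - \<kappa> = (real N * \<beta> * real H ^ Suc s) powr - \<kappa>"
      using pos by (simp add: X_def mult_ac flip: powr_mult)
    also have "2 / real H \<le> 2 * real H powr - \<kappa>"
    proof -
      have "real H powr -1 \<le> real H powr - \<kappa>" using \<kappa> H by (intro powr_mono) auto
      then show ?thesis using pos by (simp add: powr_minus divide_inverse)
    qed
    finally have "x\<^sup>2 \<le> 2 * real H powr - \<kappa> + 4 * C * real H powr - \<kappa> +
        8 * C * (real N * \<beta> * real H ^ Suc s) powr - \<kappa>" by simp
    also have "\<dots> \<le> (2 + 8 * C) * (real H powr - \<kappa> + (real N * \<beta> * real H ^ Suc s) powr - \<kappa>)"
      using C by (simp add: algebra_simps)
    finally have x2: "x\<^sup>2 \<le> (2 + 8 * C) * (real H powr - \<kappa> + (real N * \<beta> * real H ^ Suc s) powr - \<kappa>)" .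
    define a b where "a = real H powr - (\<kappa> / 2)" and "b = (real N * \<beta> * real H ^ Suc s) powr - (\<kappa> / 2)"
    have ab: "a \<ge> 0" "b \<ge> 0" "real H powr - \<kappa> = a\<^sup>2" "(real N * \<beta> * real H ^ Suc s) powr - \<kappa> = b\<^sup>2"
      by (auto simp: a_def b_def power2_eq_square simp flip: powr_add)
    have "x\<^sup>2 \<le> (2 + 8 * C) * (a\<^sup>2 + b\<^sup>2)" using x2 unfolding ab(3,4) .
    also have "\<dots> \<le> (2 + 8 * C)\<^sup>2 * (a + b)\<^sup>2"
    proof (intro mult_mono)
      show "2 + 8 * C \<le> (2 + 8 * C)\<^sup>2" using C by (intro self_le_power) auto
      show "a\<^sup>2 + b\<^sup>2 \<le> (a + b)\<^sup>2" using ab(1,2) by (simp add: power2_sum)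
    qed auto
    finally have "x\<^sup>2 \<le> ((2 + 8 * C) * (a + b))\<^sup>2" by (simp add: power_mult_distrib)
    then have "x \<le> (2 + 8 * C) * (a + b)"
      by (rule power2_le_imp_le) (use C ab in auto)
    then show "norm (\<Sum>k<n. cis (poly p (real k))) / real N
       \<le> (2 + 8 * C) * (real H powr - (\<kappa> / 2) +
              (real N * coeff p (Suc (Suc s)) * real H ^ Suc s) powr - (\<kappa> / 2))"
      unfolding x_def a_def b_def \<beta>_def .
  qed
qed

text \<open>Differencing multiplies the leading coefficient by a nonzero integer and so preserves
  its irrationality modulo 2 pi. For a linear phase, irrationality keeps the ratio of the geometric
  sum away from 1, and the sum stays bounded.\<close>

lemma weyl_sum_mean_tendsto_0:
  assumes "degree p \<le> Suc s" and "coeff p (Suc s) / (2 * pi) \<notin> \<rat>"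
  shows "(\<lambda>n. norm (\<Sum>k<n. cis (poly p (real k))) / real n) \<longlonglongrightarrow> 0"
  using assms
proof (induction s arbitrary: p)
  case 0
  define \<beta> where "\<beta> = coeff p (Suc 0)"
  have ne: "cis \<beta> \<noteq> 1"
  proof
    assume "cis \<beta> = 1"
    then have "cos \<beta> = 1" by (metis cis.simps(1) one_complex.simps(1))
    then obtain m :: int where "\<beta> = of_int m * 2 * pi"
      using cos_one_2pi_int by auto
    then have "\<beta> / (2 * pi) = of_int m" by simp
    then show False using 0 unfolding \<beta>_def by simp
  qed
  have "norm (\<Sum>k<n. cis (poly p (real k))) \<le> 2 / norm (cis \<beta> - 1)" for n
    using norm_sum_cis_linear_le[OF ne, of "coeff p 0" n]
    unfolding poly_degree_le_1[OF 0(1)] \<beta>_def .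
  then have "norm (norm (\<Sum>k<n. cis (poly p (real k))) / real n) \<le> (2 / norm (cis \<beta> - 1)) / real n" for n
    unfolding real_norm_def abs_of_nonneg[OF divide_nonneg_nonneg[OF norm_ge_zero of_nat_0_le_iff]]
    by (intro divide_right_mono) auto
  then show ?case
    by (intro Lim_null_comparison[OF always_eventually lim_const_over_n[of "2 / norm (cis \<beta> - 1)"]]) blast
next
  case (Suc s)
  define c where "c d n = norm (\<Sum>k<n - d. cis (poly (pcompose p [:real d, 1:] - p) (real k))) / real n" for d n
  define x where "x n = norm (\<Sum>k<n. cis (poly p (real k))) / real n" for n
  have c_lim: "c d \<longlonglongrightarrow> 0" if "1 \<le> d" for d
  proof -
    let ?q = "pcompose p [:real d, 1:] - p"
    have q: "degree ?q \<le> Suc s" "coeff ?q (Suc s) = real (Suc (Suc s)) * real d * coeff p (Suc (Suc s))"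
      using difference_poly[OF Suc.prems(1), of "real d"] by auto
    have "coeff ?q (Suc s) / (2 * pi) \<notin> \<rat>"
    proof
      assume "coeff ?q (Suc s) / (2 * pi) \<in> \<rat>"
      then have "coeff ?q (Suc s) / (2 * pi) / (real (Suc (Suc s)) * real d) \<in> \<rat>"
        by (rule Rats_divide) (intro Rats_mult Rats_of_nat)
      also have "coeff ?q (Suc s) / (2 * pi) / (real (Suc (Suc s)) * real d) = coeff p (Suc (Suc s)) / (2 * pi)"
        unfolding q(2) using that by (simp del: of_nat_Suc)
      finally show False using Suc.prems(2) by simp
    qed
    then have "(\<lambda>n. norm (\<Sum>k<n. cis (poly ?q (real k))) / real n) \<longlonglongrightarrow> 0"
      by (rule Suc.IH[OF q(1)])
    then have lim: "(\<lambda>n. norm (\<Sum>k<n - d. cis (poly ?q (real k))) / real (n - d)) \<longlonglongrightarrow> 0"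
      by (rule filterlim_compose[OF _ filterlim_minus_const_nat_at_top])
    have "norm (c d n) \<le> norm (\<Sum>k<n - d. cis (poly ?q (real k))) / real (n - d)" for n
    proof (cases "n \<le> d")
      case False
      then show ?thesis unfolding c_def by (auto intro!: divide_left_mono mult_pos_pos)
    qed (simp add: c_def)
    then show ?thesis
      by (intro Lim_null_comparison[OF always_eventually lim]) auto
  qed
  have "x \<longlonglongrightarrow> 0"
  proof (rule LIMSEQ_I)
    fix \<epsilon> :: real assume \<epsilon>: "0 < \<epsilon>"
    \<comment> \<open>H is fixed before n grows. The H - 1 correlations then eventually add up to
      less than 1 / 2, and the van der Corput bound is at most 4 / H.\<close>
    obtain H :: nat where "4 / \<epsilon>\<^sup>2 < real H" using reals_Archimedean2 by blast
    then have H: "4 / real H < \<epsilon>\<^sup>2" "1 \<le> H"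
      using \<epsilon> by (cases H; simp add: field_simps)+
    have "(\<lambda>n. \<Sum>d = 1..<H. c d n) \<longlonglongrightarrow> (\<Sum>d = 1..<H. 0)"
      by (intro tendsto_sum c_lim) auto
    then have "\<forall>\<^sub>F n in sequentially. (\<Sum>d = 1..<H. c d n) < 1 / 2"
      by (intro order_tendstoD(2)) auto
    moreover have "\<forall>\<^sub>F n in sequentially. H \<le> n" by (rule eventually_ge_at_top)
    ultimately have "\<forall>\<^sub>F n in sequentially. norm (x n - 0) < \<epsilon>"
    proof eventually_elim
      case (elim n)
      have "(x n)\<^sup>2 \<le> 2 / real H * (1 + 2 * (\<Sum>d = 1..<H. c d n))"
        unfolding x_def c_def using H elim by (intro weyl_sum_step) auto
      also have "\<dots> \<le> 2 / real H * 2"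
        using elim by (intro mult_left_mono) auto
      also have "\<dots> < \<epsilon>\<^sup>2" using H by simp
      finally have "x n < \<epsilon>" by (rule power_less_imp_less_base) (use \<epsilon> in simp)
      then show ?case by (simp add: x_def)
    qed
    then show "\<exists>no. \<forall>n\<ge>no. norm (x n - 0) < \<epsilon>" by (simp add: eventually_sequentially)
  qed
  then show ?case unfolding x_def .
qed

section \<open>Cesaro weights\<close>

lemma cesaro_number_0 [simp]: "cesaro_number \<beta> 0 = 1"
  by (simp add: cesaro_number_eq_prod)

lemma cesaro_number_Suc:
  "cesaro_number \<beta> (Suc n) = cesaro_number \<beta> n * ((\<beta> + real (Suc n)) / real (Suc n))"
  by (simp add: cesaro_number_eq_prod)

lemma cesaro_number_pos: "\<beta> > -1 \<Longrightarrow> cesaro_number \<beta> n > 0"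
  unfolding cesaro_number_eq_prod by (intro prod_pos) auto

lemma cesaro_number_diff:
  assumes "\<alpha> > 0"
  shows "cesaro_number (\<alpha> - 1) n * (real n + \<alpha>) = \<alpha> * cesaro_number \<alpha> n"
proof (induction n)
  case (Suc n)
  have "cesaro_number (\<alpha> - 1) (Suc n) = cesaro_number (\<alpha> - 1) n * (real n + \<alpha>) / real (Suc n)"
    by (simp add: cesaro_number_Suc algebra_simps)
  also have "\<dots> = \<alpha> * cesaro_number \<alpha> n / real (Suc n)" by (simp only: Suc)
  finally show ?case by (simp add: cesaro_number_Suc algebra_simps)
qed simp

lemma sum_cesaro_number:
  assumes "\<alpha> > 0"
  shows "(\<Sum>i\<le>n. cesaro_number (\<alpha> - 1) i) = cesaro_number \<alpha> n"
proof (induction n)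
  case (Suc n)
  have "cesaro_number (\<alpha> - 1) (Suc n) = cesaro_number (\<alpha> - 1) n * (real n + \<alpha>) / real (Suc n)"
    by (simp add: cesaro_number_Suc algebra_simps)
  also have "\<dots> = \<alpha> * cesaro_number \<alpha> n / real (Suc n)"
    by (simp only: cesaro_number_diff[OF assms])
  finally show ?case using Suc by (simp add: cesaro_number_Suc field_simps)
qed simp

text \<open>Each factor (n + \<alpha>) / (n + 1) is at most 1. In the means the index is N - k, so
  as a function of k the weights increase, as Abel summation with a bound by the last weight
  requires.\<close>

lemma cesaro_number_antimono:
  assumes "0 < \<alpha>" and "\<alpha> \<le> 1" and "m \<le> n"
  shows "cesaro_number (\<alpha> - 1) n \<le> cesaro_number (\<alpha> - 1) m"
  using \<open>m \<le> n\<close>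
proof (rule lift_Suc_antimono_le[rotated])
  fix n
  show "cesaro_number (\<alpha> - 1) (Suc n) \<le> cesaro_number (\<alpha> - 1) n"
    using assms cesaro_number_pos[of "\<alpha> - 1" n]
    unfolding cesaro_number_Suc by (intro mult_left_le) (auto simp: divide_le_eq)
qed

text \<open>Bernoulli's inequality for exponents up to 1, as the weighted arithmetic-geometric mean
  inequality for 1 + x and 1.\<close>

lemma one_plus_powr_le:
  assumes "0 \<le> x" and "0 < \<alpha>" and "\<alpha> \<le> (1::real)"
  shows "(1 + x) powr \<alpha> \<le> 1 + \<alpha> * x"
  using Youngs_inequality_0[of \<alpha> "1 - \<alpha>" "1 + x" 1] assms by (simp add: algebra_simps)

text \<open>A substitute for the asymptotics of order n^\<alpha>: the quotient by (n + 1)^\<alpha>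
  is nondecreasing, since one step multiplies the Cesaro number by 1 + \<alpha> / (n + 1), which
  dominates (1 + 1 / (n + 1))^\<alpha>.\<close>

lemma cesaro_number_ratio:
  assumes "0 < \<alpha>" and "\<alpha> \<le> 1" and "M \<le> N"
  shows "cesaro_number \<alpha> M \<le> ((real M + 1) / (real N + 1)) powr \<alpha> * cesaro_number \<alpha> N"
proof -
  have "cesaro_number \<alpha> M / (real M + 1) powr \<alpha> \<le> cesaro_number \<alpha> N / (real N + 1) powr \<alpha>"
    using \<open>M \<le> N\<close>
  proof (rule lift_Suc_mono_le[rotated])
    fix n
    have "(real n + 2) powr \<alpha> = (real n + 1) powr \<alpha> * (1 + 1 / (real n + 1)) powr \<alpha>"
    proof -
      have "real n + 2 = (real n + 1) * (1 + 1 / (real n + 1))" by (simp add: field_simps)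
      then show ?thesis by (simp only: powr_mult)
    qed
    also have "\<dots> \<le> (real n + 1) powr \<alpha> * (1 + \<alpha> * (1 / (real n + 1)))"
      using assms by (intro mult_left_mono one_plus_powr_le) auto
    finally have "cesaro_number \<alpha> n * (real n + 2) powr \<alpha>
        \<le> cesaro_number \<alpha> n * ((real n + 1) powr \<alpha> * (1 + \<alpha> * (1 / (real n + 1))))"
      using cesaro_number_pos[of \<alpha> n] assms by (intro mult_left_mono) auto
    also have "\<dots> = cesaro_number \<alpha> (Suc n) * (real n + 1) powr \<alpha>"
      by (simp add: cesaro_number_Suc field_simps)
    finally show "cesaro_number \<alpha> n / (real n + 1) powr \<alpha> \<le> cesaro_number \<alpha> (Suc n) / (real (Suc n) + 1) powr \<alpha>"
      by (simp add: field_simps)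
  qed
  then show ?thesis by (simp add: powr_divide field_simps)
qed

text \<open>Summation by parts. The induction follows the difference between the weighted sum and
  its boundary term; the increments of \<open>q\<close> telescope because they are
  nonnegative.\<close>

lemma norm_sum_monotone_weights_le:
  fixes z :: "nat \<Rightarrow> complex" and q :: "nat \<Rightarrow> real"
  assumes "\<And>n. n \<le> L \<Longrightarrow> norm (\<Sum>k = 1..n. z k) \<le> D"
    and "\<And>k. 1 \<le> k \<Longrightarrow> k \<le> L \<Longrightarrow> 0 \<le> q k" and "\<And>k. 1 \<le> k \<Longrightarrow> k < L \<Longrightarrow> q k \<le> q (Suc k)"
    and "1 \<le> L"
  shows "norm (\<Sum>k = 1..L. of_real (q k) * z k) \<le> 2 * q L * D"
proof -
  define Z where "Z n = (\<Sum>k = 1..n. z k)" for n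
  have D: "0 \<le> D" using assms(1)[of 0] by simp
  have "norm ((\<Sum>k = 1..n. of_real (q k) * z k) - of_real (q n) * Z n) \<le> (q n - q 1) * D"
    if "1 \<le> n" "n \<le> L" for n
    using that
  proof (induction n rule: dec_induct)
    case base
    then show ?case by (simp add: Z_def)
  next
    case (step n)
    have "(\<Sum>k = 1..Suc n. of_real (q k) * z k) - of_real (q (Suc n)) * Z (Suc n)
        = ((\<Sum>k = 1..n. of_real (q k) * z k) - of_real (q n) * Z n)
          - of_real (q (Suc n) - q n) * Z n"
      by (simp add: Z_def algebra_simps)
    also have "norm \<dots> \<le> (q n - q 1) * D + (q (Suc n) - q n) * D"
    proof (rule order_trans[OF norm_triangle_ineq4 add_mono])
      show "norm ((\<Sum>k = 1..n. of_real (q k) * z k) - of_real (q n) * Z n) \<le> (q n - q 1) * D"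
        using step by auto
      have "norm (of_real (q (Suc n) - q n) * Z n) = (q (Suc n) - q n) * norm (Z n)"
        using step assms(3)[of n] unfolding norm_mult norm_of_real by simp
      then show "norm (of_real (q (Suc n) - q n) * Z n) \<le> (q (Suc n) - q n) * D"
        using step assms(3)[of n] assms(1)[of n] by (auto simp: Z_def intro!: mult_left_mono)
    qed
    finally show ?case by (simp add: algebra_simps)
  qed
  from this[of L] have 1: "norm ((\<Sum>k = 1..L. of_real (q k) * z k) - of_real (q L) * Z L) \<le> (q L - q 1) * D"
    using assms(4) by simp
  have 2: "norm (of_real (q L) * Z L) \<le> q L * D"
    using assms(1)[of L] assms(2)[of L] assms(4) unfolding norm_mult norm_of_real Z_def
    by (auto intro!: mult_left_mono)
  have "norm (\<Sum>k = 1..L. of_real (q k) * z k) \<le> (q L - q 1) * D + q L * D"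
    using norm_triangle_mono[OF 1 2] by simp
  also have "\<dots> \<le> 2 * q L * D"
    using mult_nonneg_nonneg[OF assms(2)[of 1] D] assms(4) by (simp add: algebra_simps)
  finally show ?thesis .
qed

text \<open>For B < 1 the sum is cut at N - M with M the integer part of B N. The last M terms cost
  at most their total weight, hence at most \<open>A M\<close>. On the rest Abel summation costs 2
  \<open>w M\<close> B N, which is at most 2 \<open>A M\<close> because \<open>w M\<close> is
  bounded by \<open>A M\<close> / (M + 1). Comparing 3 \<open>A M\<close> with the total weight
  gives the power B^\<alpha>. For B \<ge> 1 the total weight alone suffices.\<close>

lemma norm_cesaro_sum_le:
  fixes z :: "nat \<Rightarrow> complex"
  assumes \<alpha>: "0 < \<alpha>" "\<alpha> \<le> 1" and "1 \<le> N"
    and z: "\<And>k. norm (z k) \<le> 1"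
    and Z: "\<And>n. n \<le> N \<Longrightarrow> norm (\<Sum>k = 1..n. z k) \<le> B * real N"
    and B: "1 \<le> B * real N"
  shows "norm (\<Sum>k = 1..N. of_real (cesaro_number (\<alpha> - 1) (N - k)) * z k)
    \<le> 6 * B powr \<alpha> * cesaro_number \<alpha> (N - 1)"
proof -
  define w where "w = cesaro_number (\<alpha> - 1)"
  define A where "A = cesaro_number \<alpha>"
  have w0: "0 < w n" and A0: "0 < A n" for n
    using \<alpha> by (auto simp: w_def A_def intro!: cesaro_number_pos)
  have N: "real N > 0" using assms by simp
  then have B0: "B > 0" using less_le_trans[OF zero_less_one B] by (simp add: zero_less_mult_iff)
  have trivial: "norm (\<Sum>k\<in>{L<..N}. of_real (w (N - k)) * z k) \<le> A m" if "N - L \<le> Suc m" for L m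
  proof -
    have "norm (\<Sum>k\<in>{L<..N}. of_real (w (N - k)) * z k) \<le> (\<Sum>k\<in>{L<..N}. w (N - k))"
      using w0 z by (intro sum_norm_le) (simp add: norm_mult mult_left_le less_imp_le)
    also have "\<dots> = (\<Sum>i\<in>{..<N - L}. w i)"
      by (rule sum.reindex_bij_witness[where i="\<lambda>i. N - i" and j="\<lambda>k. N - k"]) auto
    also have "\<dots> \<le> (\<Sum>i\<le>m. w i)"
      using that w0 by (intro sum_mono2) (auto intro: less_imp_le)
    finally show ?thesis using sum_cesaro_number[OF \<alpha>(1)] by (simp add: w_def A_def)
  qed
  have interval: "{1..N} = {0<..N}" by auto
  show ?thesis
  proof (cases "B \<ge> 1")
    case True
    have "norm (\<Sum>k = 1..N. of_real (w (N - k)) * z k) \<le> A (N - 1)"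
      unfolding interval using assms by (intro trivial) auto
    also have "\<dots> \<le> (6 * B powr \<alpha>) * A (N - 1)"
      using ge_one_powr_ge_zero[OF True, of \<alpha>] A0[of "N - 1"] \<alpha> by simp
    finally show ?thesis by (simp add: w_def A_def)
  next
    case False
    define M where "M = nat \<lfloor>B * real N\<rfloor>"
    have M: "real M \<le> B * real N" "B * real N < real M + 1"
      using B unfolding M_def by linarith+
    have "B * real N < 1 * real N" using False N by (intro mult_strict_right_mono) auto
    then have "real M < real N" using M by linarith
    then have MN: "M \<le> N - 1" "M < N" "1 \<le> N - M" by auto
    have "norm (\<Sum>k = 1..N - M. of_real (w (N - k)) * z k) \<le> 2 * w (N - (N - M)) * (B * real N)"
      using MN w0 \<alpha>
      by (intro norm_sum_monotone_weights_le Z)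
         (auto simp: less_imp_le w_def intro!: cesaro_number_antimono)
    also have "w (N - (N - M)) = w M" using MN by simp
    also have "w M \<le> A M / (real M + 1)"
    proof -
      have "w M * \<alpha> * (real M + 1) \<le> w M * (real M + \<alpha>)"
        unfolding mult.assoc using \<alpha> w0[of M]
        by (intro mult_left_mono) (auto simp: distrib_left mult_left_le_one_le)
      also have "\<dots> = \<alpha> * A M" using cesaro_number_diff[OF \<alpha>(1)] by (simp add: w_def A_def)
      finally show ?thesis using \<alpha> by (simp add: le_divide_eq)
    qed
    also have "2 * (A M / (real M + 1)) * (B * real N) \<le> 2 * A M"
      using M A0[of M] by (simp add: divide_le_eq)
    finally have "norm (\<Sum>k = 1..N - M. of_real (w (N - k)) * z k) \<le> 2 * A M"
      using B0 N by simp
    moreover have "norm (\<Sum>k\<in>{N - M<..N}. of_real (w (N - k)) * z k) \<le> A M"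
      by (rule trivial) auto
    moreover have "(\<Sum>k = 1..N. of_real (w (N - k)) * z k)
       = (\<Sum>k = 1..N - M. of_real (w (N - k)) * z k) + (\<Sum>k\<in>{N - M<..N}. of_real (w (N - k)) * z k)"
    proof -
      have "{1..N} = {1..N - M} \<union> {N - M<..N}" using MN by auto
      then show ?thesis by (simp only:) (subst sum.union_disjoint, auto)
    qed
    ultimately have "norm (\<Sum>k = 1..N. of_real (w (N - k)) * z k) \<le> 3 * A M"
      by (smt (verit) norm_triangle_ineq)
    also have "A M \<le> ((real M + 1) / (real (N - 1) + 1)) powr \<alpha> * A (N - 1)"
      unfolding A_def by (rule cesaro_number_ratio[OF \<alpha> MN(1)])
    \<comment> \<open>Rounding is absorbed by 1 \<le> B N, which gives M + 1 \<le> 2 B N.\<close>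
    also have "((real M + 1) / (real (N - 1) + 1)) powr \<alpha> \<le> (2 * B) powr \<alpha>"
      using M B N \<alpha> \<open>1 \<le> N\<close> by (intro powr_mono2) (auto simp: of_nat_diff divide_le_eq)
    also have "(2 * B) powr \<alpha> \<le> 2 * B powr \<alpha>"
    proof -
      have "2 powr \<alpha> \<le> 2 powr (1::real)" using \<alpha> by (intro powr_mono) auto
      then show ?thesis using B0 by (simp add: powr_mult mult_right_mono)
    qed
    finally show ?thesis using A0[of "N - 1"] by (simp add: w_def A_def)
  qed
qed

section \<open>Weighted exponential sums along a polynomial\<close>

lemma powr_minus_quotient:
  fixes x y :: real
  assumes "x > 0" and "y > 0"
  shows "(x / y) powr - c = x powr - c * y powr c"
proof -
  have "(x / y) powr - c = x powr - c / y powr - c"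
    using assms by (simp add: powr_divide)
  then show ?thesis by (simp add: powr_minus_divide)
qed

text \<open>\<open>weyl_sum_bound\<close> is applied to t p with the largest admissible H. If H
  reaches N, its second term yields the power of N^(s+1) t; otherwise H is of order t^(-1/s) and
  every contribution is O(t^c). The conjunct on 1 / N lets bounded corrections of the sum be
  absorbed afterwards.\<close>

lemma weyl_sum_bound_small_frequency:
  fixes p :: "real poly"
  assumes deg: "degree p = Suc s" and s: "1 \<le> s" and lc: "coeff p (Suc s) > 0"
  shows "\<exists>C\<ge>1. \<exists>c. 0 < c \<and> c \<le> 1 \<and> (\<forall>N n t. 1 \<le> N \<longrightarrow> n \<le> N \<longrightarrow> 0 < t \<longrightarrow> 1 \<le> real N ^ Suc s * t \<longrightarrow>
    1 / real N \<le> t powr c \<and>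
    norm (\<Sum>k<n. cis (t * poly p (real k))) / real N
      \<le> C * (t powr c + (real N ^ Suc s * t) powr - c))"
proof -
  define b where "b = coeff p (Suc s)"
  define \<kappa> :: real where "\<kappa> = 1 / 2 ^ Suc s"
  \<comment> \<open>With this c, N^(-\<kappa>) equals (N^(s+1))^(-c), which is at most t^c as soon
    as N^(s+1) t \<ge> 1.\<close>
  define c where "c = \<kappa> / real (Suc s)"
  \<comment> \<open>The largest frequency at which H = 1 is still admissible for t p; beyond it t^c
    is bounded below and the trivial bound is enough.\<close>
  define t0 where "t0 = pi / (fact (Suc s) * b)"
  have b: "b > 0" using lc by (simp add: b_def)
  have "t0 > 0" using b by (simp add: t0_def)
  have \<kappa>: "0 < \<kappa>" "\<kappa> \<le> 1" by (auto simp: \<kappa>_def divide_le_eq simp del: power_Suc)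
  have c: "0 < c" "c \<le> \<kappa>" "\<kappa> = c * real (Suc s)"
    using \<kappa> by (auto simp: c_def divide_le_eq)
  have powr_c: "(x ^ Suc s) powr - c = x powr - \<kappa>" if "x > 0" for x :: real
    using that by (simp add: powr_powr c(3) mult.commute flip: powr_realpow del: power_Suc)
  obtain C where C: "C \<ge> 1" and weyl: "\<And>p H N n. degree p \<le> Suc s \<Longrightarrow> coeff p (Suc s) > 0 \<Longrightarrow>
     fact (Suc s) * coeff p (Suc s) * real H ^ s \<le> pi \<Longrightarrow> 1 \<le> H \<Longrightarrow> H \<le> N \<Longrightarrow> n \<le> N \<Longrightarrow>
     norm (\<Sum>k<n. cis (poly p (real k))) / real N
       \<le> C * (real H powr - \<kappa> + (real N * coeff p (Suc s) * real H ^ s) powr - \<kappa>)"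
    using weyl_sum_bound[of s] unfolding \<kappa>_def by blast
  define C1 C2 C3 C4 where "C1 = (t0 / 2 ^ s) powr - c" and "C2 = (b * (t0 / 2 ^ s)) powr - \<kappa>"
    and "C3 = b powr - \<kappa>" and "C4 = t0 powr - c"
  have Ci: "C1 \<ge> 0" "C2 \<ge> 0" "C3 \<ge> 0" "C4 \<ge> 0" by (auto simp: C1_def C2_def C3_def C4_def)
  define K where "K = C * (1 + C1 + C2 + C3) + C4"
  have K1: "K \<ge> 1" using Ci mult_mono[of 1 C 1 "1 + C1 + C2 + C3"] C by (simp add: K_def)
  have "1 / real N \<le> t powr c \<and> norm (\<Sum>k<n. cis (t * poly p (real k))) / real N
      \<le> K * (t powr c + (real N ^ Suc s * t) powr - c)"
    if N: "1 \<le> N" "n \<le> N" and t: "0 < t" and X: "1 \<le> real N ^ Suc s * t" for N n t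
  proof -
    define u v where "u = t powr c" and "v = (real N ^ Suc s * t) powr - c"
    have uv: "u \<ge> 0" "v \<ge> 0" by (auto simp: u_def v_def)
    have N\<kappa>: "real N powr - \<kappa> \<le> u"
    proof -
      have "real N powr - \<kappa> = (real N ^ Suc s) powr - c" using N by (intro powr_c[symmetric]) simp
      also have "\<dots> \<le> (1 / t) powr - c"
        using X t c by (intro powr_mono2') (auto simp: divide_le_eq)
      also have "\<dots> = u" using powr_minus_quotient[of 1 t c] t by (simp add: u_def)
      finally show ?thesis .
    qed
    have "real N powr - 1 \<le> real N powr - \<kappa>" using N \<kappa> by (intro powr_mono) auto
    then have first: "1 / real N \<le> u"
      using N\<kappa> N unfolding powr_minus_divide by simp
    have "norm (\<Sum>k<n. cis (t * poly p (real k))) / real N \<le> K * (u + v)"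
    proof (cases "t \<le> t0")
      case False
      have "norm (\<Sum>k<n. cis (t * poly p (real k))) / real N \<le> 1"
        using norm_sum_cis_le[of "\<lambda>k. t * poly p (real k)" n] N by simp
      also have "1 \<le> C4 * u"
      proof -
        have "1 powr - c \<le> (t0 / t) powr - c"
          using False c \<open>t0 > 0\<close> by (intro powr_mono2') auto
        then show ?thesis
          using powr_minus_quotient[OF \<open>t0 > 0\<close> t, of c] by (simp add: C4_def u_def)
      qed
      also have "\<dots> \<le> K * (u + v)"
        using Ci uv C by (intro mult_mono) (auto simp: K_def)
      finally show ?thesis .
    next
      case True
      \<comment> \<open>The condition on h^s is the premise of \<open>weyl_sum_bound\<close> for t
        p, solved for h.\<close>
      define S where "S = {h. 1 \<le> h \<and> h \<le> N \<and> real h ^ s \<le> t0 / t}"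
      define H where "H = Max S"
      have S: "finite S" "1 \<in> S" using True N t by (auto simp: S_def)
      then have "H \<in> S" unfolding H_def by (intro Max_in) auto
      then have H: "1 \<le> H" "H \<le> N" "real H ^ s \<le> t0 / t" by (auto simp: S_def)
      have maximal: "t0 / t < real (Suc H) ^ s" if "H \<noteq> N"
      proof (rule ccontr)
        assume "\<not> t0 / t < real (Suc H) ^ s"
        then have "Suc H \<in> S" using H that by (auto simp: S_def)
        then have "Suc H \<le> H" unfolding H_def using S by (intro Max_ge) auto
        then show False by simp
      qed
      have "fact (Suc s) * (t * b) * real H ^ s \<le> fact (Suc s) * (t * b) * (t0 / t)"
        using H t b by (intro mult_left_mono) auto
      also have "\<dots> = pi" using t b by (simp add: t0_def)
      finally have le_pi: "fact (Suc s) * (t * b) * real H ^ s \<le> pi" .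
      have "norm (\<Sum>k<n. cis (poly (smult t p) (real k))) / real N
          \<le> C * (real H powr - \<kappa> + (real N * coeff (smult t p) (Suc s) * real H ^ s) powr - \<kappa>)"
        using H N t b deg le_pi by (intro weyl) (auto simp: b_def)
      then have main: "norm (\<Sum>k<n. cis (t * poly p (real k))) / real N
          \<le> C * (real H powr - \<kappa> + (real N * (t * b) * real H ^ s) powr - \<kappa>)"
        by (simp add: b_def)
      have "real H powr - \<kappa> + (real N * (t * b) * real H ^ s) powr - \<kappa>
        \<le> (1 + C1 + C2 + C3) * (u + v)"
      proof (cases "H = N")
        case True
        have "(real N * (t * b) * real H ^ s) powr - \<kappa> = C3 * (real N ^ Suc s * t) powr - \<kappa>"
          unfolding True C3_def using b N t by (subst powr_mult[symmetric]) (auto simp: mult_ac)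
        also have "\<dots> \<le> C3 * v"
          unfolding v_def using X c Ci by (intro mult_left_mono powr_mono) auto
        finally have "real H powr - \<kappa> + (real N * (t * b) * real H ^ s) powr - \<kappa> \<le> u + C3 * v"
          using N\<kappa> True by simp
        also have "\<dots> \<le> (1 + C1 + C2 + C3) * (u + v)"
        proof -
          have "u \<le> (1 + C1 + C2 + C3) * u" "C3 * v \<le> (1 + C1 + C2 + C3) * v"
            using mult_right_mono[of 1 "1 + C1 + C2 + C3" u]
              mult_right_mono[of C3 "1 + C1 + C2 + C3" v] uv Ci by auto
          then show ?thesis by (simp add: distrib_left)
        qed
        finally show ?thesis .
      next
        case False
        \<comment> \<open>Here H was stopped by the frequency and not by N. As H + 1 \<le> 2 H, the
          power H^s equals t0 / t up to the factor 2^s.\<close>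
        have "t0 / t \<le> real (Suc H) ^ s" using maximal[OF False] by simp
        also have "\<dots> \<le> (2 * real H) ^ s" using H by (intro power_mono) auto
        finally have Hs: "t0 / 2 ^ s / t \<le> real H ^ s"
          using t by (simp add: power_mult_distrib field_simps)
        have "real H powr - \<kappa> = (real H ^ Suc s) powr - c" using H by (intro powr_c[symmetric]) simp
        also have "\<dots> \<le> (t0 / 2 ^ s / t) powr - c"
        proof (rule powr_mono2')
          have "real H ^ s \<le> real H ^ Suc s" using H by (intro power_increasing) auto
          then show "t0 / 2 ^ s / t \<le> real H ^ Suc s" using Hs by linarith
        qed (use \<open>t0 > 0\<close> t c in auto)
        also have "\<dots> = C1 * u"
          using t \<open>t0 > 0\<close> unfolding C1_def u_def by (intro powr_minus_quotient) auto
        finally have 1: "real H powr - \<kappa> \<le> C1 * u" .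
        have "(real N * (t * b) * real H ^ s) powr - \<kappa> \<le> (real N * (b * (t0 / 2 ^ s))) powr - \<kappa>"
        proof (rule powr_mono2')
          have "real N * (t * b) * (t0 / 2 ^ s / t) \<le> real N * (t * b) * real H ^ s"
            using Hs t b by (intro mult_left_mono) auto
          then show "real N * (b * (t0 / 2 ^ s)) \<le> real N * (t * b) * real H ^ s"
            using t by (simp add: mult_ac)
        qed (use \<open>t0 > 0\<close> b N \<kappa> in auto)
        also have "\<dots> = C2 * real N powr - \<kappa>"
          unfolding C2_def using \<open>t0 > 0\<close> b by (subst powr_mult) (auto simp: mult.commute)
        also have "\<dots> \<le> C2 * u" using N\<kappa> Ci by (intro mult_left_mono) auto
        finally have "real H powr - \<kappa> + (real N * (t * b) * real H ^ s) powr - \<kappa> \<le> (C1 + C2) * u"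
          using 1 by (simp add: distrib_right)
        also have "\<dots> \<le> (1 + C1 + C2 + C3) * (u + v)"
          using Ci uv by (intro mult_mono) auto
        finally show ?thesis .
      qed
      then have "C * (real H powr - \<kappa> + (real N * (t * b) * real H ^ s) powr - \<kappa>)
          \<le> C * ((1 + C1 + C2 + C3) * (u + v))"
        using C by (intro mult_left_mono) auto
      also have "\<dots> \<le> K * (u + v)"
        using Ci uv unfolding mult.assoc[symmetric] K_def by (intro mult_right_mono) auto
      finally show ?thesis using main by linarith
    qed
    then show ?thesis using first unfolding u_def v_def by blast
  qed
  then have "\<forall>N n t. 1 \<le> N \<longrightarrow> n \<le> N \<longrightarrow> 0 < t \<longrightarrow> 1 \<le> real N ^ Suc s * t \<longrightarrow>
    1 / real N \<le> t powr c \<and>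
    norm (\<Sum>k<n. cis (t * poly p (real k))) / real N \<le> K * (t powr c + (real N ^ Suc s * t) powr - c)"
    by iprover
  then show ?thesis
    using K1 c(1) order_trans[OF c(2) \<kappa>(2)] by (intro exI[of _ K] conjI exI[of _ c])
qed

text \<open>Passes from the given sequence, summed from 1, to the polynomial, summed from 0. At most
  K terms differ, each by at most 2, and the end terms \<open>y n\<close> and \<open>z 0\<close> add
  1 each.\<close>

lemma norm_sum_shift_le:
  fixes y z :: "nat \<Rightarrow> complex"
  assumes "\<And>k. norm (z k) \<le> 1" and "\<And>k. norm (y k) \<le> 1" and "\<And>k. K \<le> k \<Longrightarrow> z k = y k"
  shows "norm (\<Sum>k = 1..n. z k) \<le> norm (\<Sum>k<n. y k) + 2 * real (Suc K)"
proof -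
  have "(\<Sum>k = 1..n. z k) = (\<Sum>k<Suc n. z k) - z 0"
    by (subst sum.lessThan_Suc_shift) (simp add: sum.atLeast1_atMost_eq)
  also have "\<dots> = (\<Sum>k<n. y k) + (\<Sum>k<Suc n. z k - y k) + y n - z 0"
    by (simp add: sum_subtractf)
  finally have eq: "(\<Sum>k = 1..n. z k) = (\<Sum>k<n. y k) + (\<Sum>k<Suc n. z k - y k) + y n - z 0" .
  have "norm (\<Sum>k<Suc n. z k - y k) \<le> (\<Sum>k<Suc n. if k < K then 2 else 0)"
  proof (intro sum_norm_le)
    fix k
    show "norm (z k - y k) \<le> (if k < K then 2 else 0)"
      using norm_triangle_ineq4[of "z k" "y k"] assms(1)[of k] assms(2)[of k] assms(3)[of k] by auto
  qed
  also have "\<dots> = (\<Sum>k\<in>{..<Suc n} \<inter> {..<K}. 2)"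
    by (subst sum.inter_restrict) (auto intro: sum.cong)
  also have "\<dots> \<le> 2 * real K"
    using card_mono[of "{..<K}" "{..<Suc n} \<inter> {..<K}"] by simp
  finally have d: "norm (\<Sum>k<Suc n. z k - y k) \<le> 2 * real K" .
  have "norm (\<Sum>k = 1..n. z k) \<le> norm (\<Sum>k<n. y k) + norm (\<Sum>k<Suc n. z k - y k) + norm (y n) + norm (z 0)"
    unfolding eq
    using norm_triangle_ineq4[of "(\<Sum>k<n. y k) + (\<Sum>k<Suc n. z k - y k) + y n" "z 0"]
      norm_triangle_ineq[of "(\<Sum>k<n. y k) + (\<Sum>k<Suc n. z k - y k)" "y n"]
      norm_triangle_ineq[of "\<Sum>k<n. y k" "\<Sum>k<Suc n. z k - y k"] by linarith
  then show ?thesis using d assms(1)[of 0] assms(2)[of n] by simp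
qed

text \<open>The weighted Weyl sum W_N; for N \<ge> 1 and \<alpha> > 0 its normalised weights add up
  to 1.\<close>

definition cesaro_exp_sum :: "real \<Rightarrow> (nat \<Rightarrow> nat) \<Rightarrow> nat \<Rightarrow> real \<Rightarrow> complex" where
  "cesaro_exp_sum \<alpha> a N t =
    (\<Sum>k = 1..N. of_real (cesaro_number (\<alpha> - 1) (N - k)) * cis (t * real (a k)))
      / of_real (cesaro_number \<alpha> (N - 1))"

lemma norm_cesaro_exp_sum_le:
  assumes \<alpha>: "0 < \<alpha>" "\<alpha> \<le> 1" and "1 \<le> N"
    and Z: "\<And>n. n \<le> N \<Longrightarrow> norm (\<Sum>k = 1..n. cis (t * real (a k))) \<le> B * real N"
    and B: "1 \<le> B * real N"
  shows "norm (cesaro_exp_sum \<alpha> a N t) \<le> 6 * B powr \<alpha>"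
proof -
  have "cesaro_number \<alpha> (N - 1) > 0" using \<alpha> by (intro cesaro_number_pos) simp
  then show ?thesis
    using norm_cesaro_sum_le[OF \<alpha> \<open>1 \<le> N\<close> _ Z B]
    by (simp add: cesaro_exp_sum_def norm_divide divide_le_eq)
qed

lemma cesaro_exp_sum_bound:
  fixes p :: "real poly"
  assumes \<alpha>: "0 < \<alpha>" "\<alpha> \<le> 1"
    and deg: "degree p = Suc s" and s: "1 \<le> s" and lc: "coeff p (Suc s) > 0"
    and a: "\<And>k. K \<le> k \<Longrightarrow> real (a k) = poly p (real k)"
  shows "\<exists>C\<ge>1. \<exists>c. 0 < c \<and> c \<le> 1 \<and> (\<forall>N t. 1 \<le> N \<longrightarrow> 0 < t \<longrightarrow> 1 \<le> real N ^ Suc s * t \<longrightarrow>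
    norm (cesaro_exp_sum \<alpha> a N t) \<le> C * (t powr c + (real N ^ Suc s * t) powr - c))"
proof -
  obtain C c where C: "C \<ge> 1" and c: "0 < c" "c \<le> 1"
    and weyl: "\<And>N n t. 1 \<le> N \<Longrightarrow> n \<le> N \<Longrightarrow> 0 < t \<Longrightarrow> 1 \<le> real N ^ Suc s * t \<Longrightarrow>
      1 / real N \<le> t powr c \<and>
      norm (\<Sum>k<n. cis (t * poly p (real k))) / real N \<le> C * (t powr c + (real N ^ Suc s * t) powr - c)"
    using weyl_sum_bound_small_frequency[OF deg s lc] by blast
  \<comment> \<open>The additive error 2 (K + 1) becomes part of the constant, since 1 \<le> u N for
    the u = t^c below.\<close>
  define D where "D = C + 2 * real (Suc K)"
  have D: "D \<ge> 1" using C by (simp add: D_def)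
  have "norm (cesaro_exp_sum \<alpha> a N t)
      \<le> (12 * D) * (t powr (c * \<alpha>) + (real N ^ Suc s * t) powr - (c * \<alpha>))"
    if N: "1 \<le> N" and t: "0 < t" and X: "1 \<le> real N ^ Suc s * t" for N t
  proof -
    define u v where "u = t powr c" and "v = (real N ^ Suc s * t) powr - c"
    \<comment> \<open>The maximum distributes the power \<alpha> over the two terms: (u +
      v)^\<alpha> is at most (2 m)^\<alpha>, and m^\<alpha> is one of the two powers.\<close>
    define m where "m = max u v"
    have uv: "u > 0" "v > 0" "1 / real N \<le> u" "m > 0"
      using weyl[OF N _ t X, of 0] t N by (auto simp: u_def v_def m_def less_max_iff_disj)
    have "norm (cesaro_exp_sum \<alpha> a N t) \<le> 6 * (D * (u + v)) powr \<alpha>"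
    proof (rule norm_cesaro_exp_sum_le[OF \<alpha> N])
      fix n assume n: "n \<le> N"
      have "norm (\<Sum>k = 1..n. cis (t * real (a k)))
          \<le> norm (\<Sum>k<n. cis (t * poly p (real k))) + 2 * real (Suc K)"
        by (rule norm_sum_shift_le) (auto simp: a)
      also have "norm (\<Sum>k<n. cis (t * poly p (real k))) \<le> C * (u + v) * real N"
        using weyl[OF N n t X] N by (simp add: u_def v_def divide_le_eq)
      also have "2 * real (Suc K) \<le> 2 * real (Suc K) * (u * real N)"
        using uv N mult_left_mono[of 1 "u * real N" "2 * real (Suc K)"] by (simp add: divide_le_eq)
      also have "\<dots> \<le> 2 * real (Suc K) * ((u + v) * real N)"
        using uv by (intro mult_left_mono mult_right_mono) auto
      finally show "norm (\<Sum>k = 1..n. cis (t * real (a k))) \<le> D * (u + v) * real N"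
        by (simp add: D_def algebra_simps)
    next
      have "1 \<le> u * real N" using uv N by (simp add: divide_le_eq)
      also have "\<dots> \<le> D * (u + v) * real N"
        using uv D mult_mono[of 1 D u "u + v"] by (intro mult_right_mono) auto
      finally show "1 \<le> D * (u + v) * real N" .
    qed
    also have "(D * (u + v)) powr \<alpha> \<le> (D * (2 * m)) powr \<alpha>"
      using uv D \<alpha> by (intro powr_mono2 mult_left_mono) (auto simp: m_def)
    also have "\<dots> = (2 * D) powr \<alpha> * m powr \<alpha>"
      using uv D by (subst powr_mult[symmetric]) (auto simp: mult_ac)
    also have "(2 * D) powr \<alpha> * m powr \<alpha> \<le> (2 * D) * (u powr \<alpha> + v powr \<alpha>)"
    proof (rule mult_mono)
      have "(2 * D) powr \<alpha> \<le> (2 * D) powr 1"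
        using D \<alpha> by (intro powr_mono) auto
      then show "(2 * D) powr \<alpha> \<le> 2 * D" using D by simp
    qed (use D in \<open>auto simp: m_def max_def\<close>)
    finally show ?thesis using D by (simp add: u_def v_def powr_powr mult.assoc)
  qed
  then have "\<forall>N t. 1 \<le> N \<longrightarrow> 0 < t \<longrightarrow> 1 \<le> real N ^ Suc s * t \<longrightarrow>
    norm (cesaro_exp_sum \<alpha> a N t)
      \<le> (12 * D) * (t powr (c * \<alpha>) + (real N ^ Suc s * t) powr - (c * \<alpha>))"
    by iprover
  moreover have "0 < c * \<alpha>" "c * \<alpha> \<le> 1" using c \<alpha> by (auto intro: mult_le_one)
  moreover have "1 \<le> 12 * D" using D by simp
  ultimately show ?thesis by (intro exI[of _ "12 * D"] conjI exI[of _ "c * \<alpha>"])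
qed

lemma cesaro_exp_sum_tendsto_0:
  fixes p :: "real poly"
  assumes \<alpha>: "0 < \<alpha>" "\<alpha> \<le> 1"
    and deg: "degree p = Suc s" and irr: "t * coeff p (Suc s) / (2 * pi) \<notin> \<rat>"
    and a: "\<And>k. K \<le> k \<Longrightarrow> real (a k) = poly p (real k)"
  shows "(\<lambda>N. cesaro_exp_sum \<alpha> a N t) \<longlonglongrightarrow> 0"
proof (rule LIMSEQ_I)
  fix \<epsilon> :: real assume \<epsilon>: "0 < \<epsilon>"
  \<comment> \<open>Chosen so that the bound 6 \<eta>^\<alpha> of
    \<open>norm_cesaro_exp_sum_le\<close> is 6 \<epsilon> / 7 < \<epsilon>.\<close>
  define \<eta> where "\<eta> = (\<epsilon> / 7) powr (1 / \<alpha>)"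
  have \<eta>: "\<eta> > 0" "\<eta> powr \<alpha> = \<epsilon> / 7" using \<epsilon> \<alpha> by (auto simp: \<eta>_def powr_powr)
  have "(\<lambda>n. norm (\<Sum>k<n. cis (poly (smult t p) (real k))) / real n) \<longlonglongrightarrow> 0"
    using deg irr by (intro weyl_sum_mean_tendsto_0[of _ s]) (auto intro: order_trans[OF degree_smult_le])
  then have "(\<lambda>n. norm (\<Sum>k<n. cis (t * poly p (real k))) / real n + 2 * real (Suc K) / real n) \<longlonglongrightarrow> 0 + 0"
    by (intro tendsto_add lim_const_over_n) simp
  then have "\<forall>\<^sub>F n in sequentially. norm (\<Sum>k<n. cis (t * poly p (real k))) / real n + 2 * real (Suc K) / real n < \<eta>"
    using \<eta> by (intro order_tendstoD(2)) auto
  then obtain M where M: "\<And>n. M \<le> n \<Longrightarrow>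
      norm (\<Sum>k<n. cis (t * poly p (real k))) / real n + 2 * real (Suc K) / real n < \<eta>"
    by (auto simp: eventually_sequentially)
  \<comment> \<open>For such N, sums of fewer than M terms are below \<eta> N without any
    cancellation, and 1 \<le> \<eta> N holds as well.\<close>
  obtain N0 :: nat where "(real M + 1) / \<eta> < real N0" using reals_Archimedean2 by blast
  then have N0: "real M + 1 < \<eta> * real N0" using \<eta> by (simp add: field_simps)
  have "norm (cesaro_exp_sum \<alpha> a N t) < \<epsilon>" if N: "N0 \<le> N" for N
  proof -
    have "\<eta> * real N0 \<le> \<eta> * real N" using N \<eta> by (intro mult_left_mono) auto
    then have NM: "real M + 1 < \<eta> * real N" using N0 by linarith
    then have N1: "1 \<le> N" by (cases N) auto
    have "norm (cesaro_exp_sum \<alpha> a N t) \<le> 6 * \<eta> powr \<alpha>"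
    proof (rule norm_cesaro_exp_sum_le[OF \<alpha> N1])
      fix n assume n: "n \<le> N"
      show "norm (\<Sum>k = 1..n. cis (t * real (a k))) \<le> \<eta> * real N"
      proof (cases "M \<le> n \<and> n > 0")
        case True
        have "norm (\<Sum>k = 1..n. cis (t * real (a k)))
            \<le> norm (\<Sum>k<n. cis (t * poly p (real k))) + 2 * real (Suc K)"
          by (rule norm_sum_shift_le) (auto simp: a)
        also have "\<dots> = (norm (\<Sum>k<n. cis (t * poly p (real k))) / real n + 2 * real (Suc K) / real n) * real n"
          using True by (simp add: distrib_right del: of_nat_Suc)
        also have "\<dots> \<le> \<eta> * real n" using M[of n] True by (intro mult_right_mono) auto
        also have "\<dots> \<le> \<eta> * real N" using n \<eta> by simp
        finally show ?thesis .
      next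
        case False
        have "norm (\<Sum>k = 1..n. cis (t * real (a k))) \<le> real n"
          using norm_sum[of "\<lambda>k. cis (t * real (a k))" "{1..n}"] by simp
        then show ?thesis using False NM by auto
      qed
    qed (use NM in simp)
    then show ?thesis using \<eta> \<epsilon> by simp
  qed
  then show "\<exists>N0. \<forall>N\<ge>N0. norm (cesaro_exp_sum \<alpha> a N t - 0) < \<epsilon>" by auto
qed

section \<open>Dirichlet kernel and partial sums\<close>

lemma set_integral_Icc_shift:
  fixes g :: "real \<Rightarrow> 'a::euclidean_space"
  assumes "set_integrable lebesgue {u..v} g"
  shows "set_integrable lebesgue {u - d..v - d} (\<lambda>t. g (d + t))"
    and "(LINT t:{u - d..v - d}|lebesgue. g (d + t)) = (LINT t:{u..v}|lebesgue. g t)"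
proof -
  let ?F = "\<lambda>t. indicator {u..v} t *\<^sub>R g t"
  have "has_bochner_integral lebesgue ?F (LINT t:{u..v}|lebesgue. g t)"
    using assms unfolding set_integrable_def set_lebesgue_integral_def
    by (simp add: has_bochner_integral_iff)
  then have "has_bochner_integral lebesgue (\<lambda>t. ?F (d + 1 * t)) ((LINT t:{u..v}|lebesgue. g t) /\<^sub>R \<bar>1\<bar>)"
    by (subst (asm) has_bochner_integral_lebesgue_real_affine_iff[of 1 _ _ d]) auto
  moreover have "(\<lambda>t. ?F (d + 1 * t)) = (\<lambda>t. indicator {u - d..v - d} t *\<^sub>R g (d + t))"
    by (simp add: indicator_def diff_le_eq le_diff_eq add.commute)
  ultimately have "has_bochner_integral lebesgue (\<lambda>t. indicator {u - d..v - d} t *\<^sub>R g (d + t))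
      (LINT t:{u..v}|lebesgue. g t)" by simp
  then show "set_integrable lebesgue {u - d..v - d} (\<lambda>t. g (d + t))"
    and "(LINT t:{u - d..v - d}|lebesgue. g (d + t)) = (LINT t:{u..v}|lebesgue. g t)"
    unfolding set_integrable_def set_lebesgue_integral_def has_bochner_integral_iff by auto
qed

lemma LINT_sum:
  fixes g :: "'i \<Rightarrow> 'b \<Rightarrow> 'a::{banach, second_countable_topology}"
  assumes "\<And>i. i \<in> I \<Longrightarrow> set_integrable M A (g i)"
  shows "(LINT t:A|M. \<Sum>i\<in>I. g i t) = (\<Sum>i\<in>I. LINT t:A|M. g i t)"
  using assms unfolding set_lebesgue_integral_def set_integrable_def scaleR_sum_right
  by (rule Bochner_Integration.integral_sum)

lemma LINT_Icc_combine:
  fixes g :: "real \<Rightarrow> 'a::euclidean_space"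
  assumes "u \<le> v" and "v \<le> w"
    and "set_integrable lebesgue {u..v} g" and "set_integrable lebesgue {v..w} g"
  shows "set_integrable lebesgue {u..w} g"
    and "(LINT t:{u..w}|lebesgue. g t) = (LINT t:{u..v}|lebesgue. g t) + (LINT t:{v..w}|lebesgue. g t)"
proof -
  have "{u..w} = {u..v} \<union> {v..w}" using assms by auto
  then show uw: "set_integrable lebesgue {u..w} g"
    using set_integrable_Un[OF assms(3,4)] by simp
  show "(LINT t:{u..w}|lebesgue. g t) = (LINT t:{u..v}|lebesgue. g t) + (LINT t:{v..w}|lebesgue. g t)"
    unfolding set_lebesgue_integral_eq_integral(2)[OF uw]
      set_lebesgue_integral_eq_integral(2)[OF assms(3)] set_lebesgue_integral_eq_integral(2)[OF assms(4)]
    using Henstock_Kurzweil_Integration.integral_combine[OF assms(1,2) set_lebesgue_integral_eq_integral(1)[OF uw]]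
    by simp
qed

lemma periodic_int_multiple:
  fixes g :: "real \<Rightarrow> 'a" and m :: int
  assumes "\<And>t. g (t + p) = g t"
  shows "g (t + of_int m * p) = g t"
proof -
  have nat: "g (t + of_nat n * p) = g t" for n t
  proof (induction n)
    case (Suc n)
    have "g (t + of_nat (Suc n) * p) = g ((t + of_nat n * p) + p)" by (simp add: algebra_simps)
    also have "\<dots> = g t" unfolding assms by (rule Suc)
    finally show ?case .
  qed simp
  show ?thesis
  proof (cases m)
    case (nonneg n)
    then show ?thesis using nat by simp
  next
    case (neg n)
    have "of_int m = - real (Suc n)" unfolding neg by simp
    then have "t + of_int m * p + of_nat (Suc n) * p = t" by (simp add: algebra_simps del: of_nat_Suc)
    then show ?thesis using nat[of "t + of_int m * p" "Suc n"] by (simp only:)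
  qed
qed

text \<open>The window [a, a + p] contains a point q = c + m p. Its part left of q, moved by one
  period, completes the part right of q to [q, q + p], and this interval is [c, c + p] moved by m
  periods.\<close>

lemma periodic_integral_shift:
  fixes g :: "real \<Rightarrow> 'a::euclidean_space"
  assumes "0 < p" and per: "\<And>t. g (t + p) = g t" and int: "set_integrable lebesgue {c..c + p} g"
  shows "set_integrable lebesgue {c..c + p} (\<lambda>t. g (x + t))"
    and "(LINT t:{c..c + p}|lebesgue. g (x + t)) = (LINT t:{c..c + p}|lebesgue. g t)"
proof -
  define a where "a = c + x"
  define m where "m = \<lceil>(a - c) / p\<rceil>"
  define q where "q = c + of_int m * p"
  have m: "(a - c) / p \<le> of_int m" "of_int m < (a - c) / p + 1" unfolding m_def by linarith+
  have q: "a \<le> q" "q \<le> a + p"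
    using m \<open>0 < p\<close> by (auto simp: q_def field_simps)
  have mult: "g (of_int k * p + t) = g t" for k :: int and t
    using periodic_int_multiple[of g p t k, OF per] by (simp add: add.commute)
  have 1: "set_integrable lebesgue {q..q + p} g"
    "(LINT t:{q..q + p}|lebesgue. g t) = (LINT t:{c..c + p}|lebesgue. g t)"
    using set_integral_Icc_shift[OF int, of "- of_int m * p"] mult[of "- m"]
    by (auto simp: q_def algebra_simps)
  have 2: "set_integrable lebesgue {q..a + p} g" "set_integrable lebesgue {a + p..q + p} g"
    using q by (auto intro: set_integrable_subset[OF 1(1)])
  have 3: "set_integrable lebesgue {a..q} g"
    "(LINT t:{a..q}|lebesgue. g t) = (LINT t:{a + p..q + p}|lebesgue. g t)"
    using set_integral_Icc_shift[OF 2(2), of p] mult[of 1] by auto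
  have "set_integrable lebesgue {a..a + p} g"
    and "(LINT t:{a..a + p}|lebesgue. g t) = (LINT t:{c..c + p}|lebesgue. g t)"
    using LINT_Icc_combine[OF q 3(1) 2(1)] LINT_Icc_combine[of q "a + p" "q + p" g, OF _ _ 2] q 1 3 by auto
  then show "set_integrable lebesgue {c..c + p} (\<lambda>t. g (x + t))"
    and "(LINT t:{c..c + p}|lebesgue. g (x + t)) = (LINT t:{c..c + p}|lebesgue. g t)"
    using set_integral_Icc_shift[of a "a + p" g x] by (auto simp: a_def)
qed

lemma periodic_integral_shift_circle:
  fixes g :: "real \<Rightarrow> complex"
  assumes "\<And>t. g (t + 2 * pi) = g t" and "set_integrable lebesgue {-pi..pi} g"
  shows "set_integrable lebesgue {-pi..pi} (\<lambda>t. g (x + t))"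
    and "(LINT t:{-pi..pi}|lebesgue. g (x + t)) = (LINT t:{-pi..pi}|lebesgue. g t)"
proof -
  have e: "- pi + 2 * pi = pi" by simp
  show "set_integrable lebesgue {-pi..pi} (\<lambda>t. g (x + t))"
    and "(LINT t:{-pi..pi}|lebesgue. g (x + t)) = (LINT t:{-pi..pi}|lebesgue. g t)"
    using periodic_integral_shift[where g = g and p = "2 * pi" and c = "- pi" and x = x, OF _ assms(1)] assms(2)
    unfolding e by simp_all
qed

lemma set_integrable_mult_continuous:
  fixes g h :: "real \<Rightarrow> 'a::{real_normed_field, second_countable_topology, banach}"
  assumes "set_integrable lebesgue {a..b} g" and "continuous_on UNIV h"
  shows "set_integrable lebesgue {a..b} (\<lambda>t. g t * h t)"
proof -
  have "continuous_on {a..b} h" using assms(2) by (rule continuous_on_subset) simp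
  from compact_continuous_image[OF this compact_Icc]
  have "bounded (h ` {a..b})" by (rule compact_imp_bounded)
  then obtain B where "\<forall>x\<in>h ` {a..b}. norm x \<le> B"
    unfolding bounded_iff ..
  then have B: "\<And>t. t \<in> {a..b} \<Longrightarrow> norm (h t) \<le> B" by simp
  have hm: "h \<in> borel_measurable lebesgue"
    using borel_measurable_continuous_onI[OF assms(2)] by (simp add: measurable_completion)
  have gm: "(\<lambda>t. indicator {a..b} t *\<^sub>R g t) \<in> borel_measurable lebesgue"
    using assms(1) unfolding set_integrable_def by (rule borel_measurable_integrable)
  have "integrable lebesgue (\<lambda>t. B *\<^sub>R (indicator {a..b} t *\<^sub>R g t))"
    using assms(1) unfolding set_integrable_def by (rule integrable_scaleR_right)
  then have "integrable lebesgue (\<lambda>t. (indicator {a..b} t *\<^sub>R g t) * h t)"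
  proof (rule Bochner_Integration.integrable_bound)
    show "(\<lambda>t. (indicator {a..b} t *\<^sub>R g t) * h t) \<in> borel_measurable lebesgue"
      using gm hm by (rule borel_measurable_times)
    show "AE t in lebesgue.
      norm ((indicator {a..b} t *\<^sub>R g t) * h t) \<le> norm (B *\<^sub>R (indicator {a..b} t *\<^sub>R g t))"
    proof (rule AE_I2)
      fix t
      show "norm ((indicator {a..b} t *\<^sub>R g t) * h t) \<le> norm (B *\<^sub>R (indicator {a..b} t *\<^sub>R g t))"
      proof (cases "t \<in> {a..b}")
        case True
        have "norm (g t) * norm (h t) \<le> norm (g t) * \<bar>B\<bar>"
          using B[OF True] by (intro mult_left_mono) auto
        then show ?thesis using True by (simp add: norm_mult mult.commute)
      qed simp
    qed
  qed
  then show ?thesis unfolding set_integrable_def by (simp add: mult.assoc)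
qed

section \<open>Dirichlet kernel\<close>

definition dirichlet_kernel :: "nat \<Rightarrow> real \<Rightarrow> real" where
  "dirichlet_kernel n t = 1 + 2 * (\<Sum>k = 1..n. cos (real k * t))"

lemma continuous_dirichlet_kernel: "continuous_on S (dirichlet_kernel n)"
  unfolding dirichlet_kernel_def by (intro continuous_intros)

lemma dirichlet_kernel_minus [simp]: "dirichlet_kernel n (- t) = dirichlet_kernel n t"
  by (simp add: dirichlet_kernel_def)

lemma abs_dirichlet_kernel_le: "\<bar>dirichlet_kernel n t\<bar> \<le> 1 + 2 * real n"
proof -
  have "\<bar>\<Sum>k = 1..n. cos (real k * t)\<bar> \<le> (\<Sum>k = 1..n. 1)"
    by (rule order_trans[OF sum_abs sum_mono]) auto
  then show ?thesis unfolding dirichlet_kernel_def by simp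
qed

text \<open>Kept as a product: the usual quotient would take the value 0 at multiples of 2 pi,
  through division by zero, where the kernel is 2 n + 1.\<close>

lemma dirichlet_kernel_sin: "dirichlet_kernel n t * sin (t / 2) = sin (t / 2 + real n * t)"
proof (induction n)
  case (Suc n)
  have "sin (t / 2 + real (Suc n) * t) - sin (t / 2 + real n * t) = 2 * cos (real (Suc n) * t) * sin (t / 2)"
    by (simp add: sin_diff_sin algebra_simps add_divide_distrib)
  then show ?case using Suc by (simp add: dirichlet_kernel_def algebra_simps)
qed (simp add: dirichlet_kernel_def)

lemma sum_exp_eq_dirichlet_kernel:
  "(\<Sum>m = - int n..int n. exp (- \<i> * of_int m * of_real t)) = of_real (dirichlet_kernel n t)"
proof (induction n)
  case (Suc n)
  have "{- int (Suc n)..int (Suc n)} = insert (int (Suc n)) (insert (- int (Suc n)) {- int n..int n})"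
    by auto
  moreover have "exp (- \<i> * of_int (int (Suc n)) * of_real t) + exp (- \<i> * of_int (- int (Suc n)) * of_real t)
      = of_real (2 * cos (real (Suc n) * t))"
  proof -
    have e: "- \<i> * of_int (int (Suc n)) * of_real t = \<i> * of_real (- (real (Suc n) * t))"
      "- \<i> * of_int (- int (Suc n)) * of_real t = \<i> * of_real (real (Suc n) * t)"
      by (simp_all add: algebra_simps)
    show ?thesis unfolding e cis_conv_exp[symmetric] by (simp add: complex_eq_iff)
  qed
  ultimately have "(\<Sum>m = - int (Suc n)..int (Suc n). exp (- \<i> * of_int m * of_real t))
      = of_real (2 * cos (real (Suc n) * t)) + of_real (dirichlet_kernel n t)"
    using Suc by (simp add: add.assoc[symmetric] del: of_int_minus)
  then show ?case by (simp add: dirichlet_kernel_def)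
qed (simp add: dirichlet_kernel_def)

lemma set_integrable_const_circle: "set_integrable lebesgue {-pi..pi} (\<lambda>t. c :: complex)"
  by (intro absolutely_integrable_continuous_real continuous_intros)

lemma exp_int_periodic: "exp (- \<i> * of_int m * of_real (t + 2 * pi)) = exp (- \<i> * of_int m * of_real t)"
proof -
  have "exp (- \<i> * of_int m * of_real (t + 2 * pi))
      = exp (- \<i> * of_int m * of_real t + \<i> * (of_int (- 2 * m) * of_real pi))"
    by (simp add: algebra_simps)
  also have "\<dots> = exp (- \<i> * of_int m * of_real t)"
    by (subst exp_eq) (auto intro!: exI[of _ "- m"])
  finally show ?thesis .
qed

lemma continuous_exp_int: "continuous_on S (\<lambda>t. exp (- \<i> * of_int m * of_real t))"
  by (intro continuous_intros)

lemma LINT_exp_circle: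
  "(LINT t:{-pi..pi}|lebesgue. exp (- \<i> * of_int m * of_real t)) = (if m = 0 then 2 * of_real pi else 0)"
proof (cases "m = 0")
  case True
  then show ?thesis by (simp add: set_lebesgue_integral_def scaleR_conv_of_real)
next
  case False
  let ?e = "\<lambda>t. exp (- \<i> * of_int m * complex_of_real t)"
  have int: "set_integrable lebesgue {-pi..pi} ?e"
    by (intro absolutely_integrable_continuous_real continuous_exp_int)
  \<comment> \<open>the shift by \<open>\<pi> / m\<close> changes the sign of the integrand\<close>
  have "?e (pi / of_int m + t) = - ?e t" for t
  proof -
    have "- \<i> * of_int m * complex_of_real (pi / of_int m + t) = - (\<i> * of_real pi) + - \<i> * of_int m * of_real t"
      using False by (simp add: field_simps)
    then have "?e (pi / of_int m + t) = exp (- (\<i> * of_real pi)) * ?e t"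
      by (simp only: exp_add)
    also have "exp (- (\<i> * of_real pi)) = (-1 :: complex)" by (simp add: exp_minus)
    finally show ?thesis by simp
  qed
  then have "(LINT t:{-pi..pi}|lebesgue. - ?e t) = (LINT t:{-pi..pi}|lebesgue. ?e t)"
    using periodic_integral_shift_circle(2)[OF exp_int_periodic int, of "pi / of_int m"] by simp
  then have "- (LINT t:{-pi..pi}|lebesgue. ?e t) = (LINT t:{-pi..pi}|lebesgue. ?e t)"
    using set_integral_uminus[OF int] by simp
  then show ?thesis using False by simp
qed

lemma LINT_dirichlet_kernel:
  "(LINT t:{-pi..pi}|lebesgue. complex_of_real (dirichlet_kernel n t)) = 2 * of_real pi"
proof -
  have "(LINT t:{-pi..pi}|lebesgue. complex_of_real (dirichlet_kernel n t))
      = (LINT t:{-pi..pi}|lebesgue. \<Sum>m = - int n..int n. exp (- \<i> * of_int m * of_real t))"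
    by (simp only: sum_exp_eq_dirichlet_kernel)
  also have "\<dots> = (\<Sum>m = - int n..int n. LINT t:{-pi..pi}|lebesgue. exp (- \<i> * of_int m * of_real t))"
    by (intro LINT_sum absolutely_integrable_continuous_real continuous_exp_int)
  also have "\<dots> = 2 * of_real pi" unfolding LINT_exp_circle by simp
  finally show ?thesis .
qed

text \<open>Translating the integration variable by x absorbs the factor exp(i m x), and f x can be
  subtracted under the integral because the kernel has integral 2 pi.\<close>

lemma fourier_partial_sum_diff_eq:
  assumes "L1_circle f"
  shows "set_integrable lebesgue {-pi..pi} (\<lambda>t. f (x + t) - f x)"
    and "fourier_partial_sum n f x - f x =
      1 / (2 * of_real pi) * (LINT t:{-pi..pi}|lebesgue. (f (x + t) - f x) * of_real (dirichlet_kernel n t))"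
proof -
  have per: "\<And>t. f (t + 2 * pi) = f t" and int: "set_integrable lebesgue {-pi..pi} f"
    using assms by (auto simp: L1_circle_def)
  have fx: "set_integrable lebesgue {-pi..pi} (\<lambda>t. f (x + t))"
    by (rule periodic_integral_shift_circle(1)[OF per int])
  show "set_integrable lebesgue {-pi..pi} (\<lambda>t. f (x + t) - f x)"
    using fx set_integrable_const_circle by (intro set_integral_diff)
  have coeff: "fourier_coeff f m * exp (\<i> * of_int m * of_real x)
      = 1 / (2 * of_real pi) * (LINT t:{-pi..pi}|lebesgue. f (x + t) * exp (- \<i> * of_int m * of_real t))" for m
  proof -
    let ?g = "\<lambda>t. f t * exp (- \<i> * of_int m * of_real t)"
    have "(LINT t:{-pi..pi}|lebesgue. ?g t) = (LINT t:{-pi..pi}|lebesgue. ?g (x + t))"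
      by (rule periodic_integral_shift_circle(2)[symmetric])
         (simp only: per exp_int_periodic, rule set_integrable_mult_continuous[OF int continuous_exp_int])
    also have "\<dots> = (LINT t:{-pi..pi}|lebesgue. exp (- \<i> * of_int m * of_real x) * (f (x + t) * exp (- \<i> * of_int m * of_real t)))"
      by (simp add: algebra_simps exp_add[symmetric])
    also have "\<dots> = exp (- \<i> * of_int m * of_real x) * (LINT t:{-pi..pi}|lebesgue. f (x + t) * exp (- \<i> * of_int m * of_real t))"
      by (rule set_integral_mult_right)
    finally have c: "fourier_coeff f m = 1 / (2 * of_real pi) * (exp (- \<i> * of_int m * of_real x) * (LINT t:{-pi..pi}|lebesgue. f (x + t) * exp (- \<i> * of_int m * of_real t)))"
      unfolding fourier_coeff_def by simp
    have rearrange: "k * (e * l) * e' = k * l" if "e * e' = 1" for k l e e' :: complex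
      using that by (metis mult.assoc mult.commute mult_1_right)
    have "exp (- \<i> * of_int m * of_real x) * exp (\<i> * of_int m * of_real x) = 1"
      by (simp flip: exp_add)
    then show ?thesis unfolding c by (rule rearrange)
  qed
  have "fourier_partial_sum n f x = 1 / (2 * of_real pi) *
      (\<Sum>m = - int n..int n. LINT t:{-pi..pi}|lebesgue. f (x + t) * exp (- \<i> * of_int m * of_real t))"
    unfolding fourier_partial_sum_def coeff by (simp only: sum_distrib_left)
  also have "(\<Sum>m = - int n..int n. LINT t:{-pi..pi}|lebesgue. f (x + t) * exp (- \<i> * of_int m * of_real t))
      = (LINT t:{-pi..pi}|lebesgue. \<Sum>m = - int n..int n. f (x + t) * exp (- \<i> * of_int m * of_real t))"
    by (intro LINT_sum[symmetric] set_integrable_mult_continuous[OF fx] continuous_exp_int)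
  also have "\<dots> = (LINT t:{-pi..pi}|lebesgue. f (x + t) * of_real (dirichlet_kernel n t))"
    by (simp only: sum_distrib_left[symmetric] sum_exp_eq_dirichlet_kernel)
  finally have S: "fourier_partial_sum n f x =
    1 / (2 * of_real pi) * (LINT t:{-pi..pi}|lebesgue. f (x + t) * of_real (dirichlet_kernel n t))" .
  have cD: "continuous_on UNIV (\<lambda>t. complex_of_real (dirichlet_kernel n t))"
    by (intro continuous_on_of_real continuous_dirichlet_kernel)
  have "(LINT t:{-pi..pi}|lebesgue. (f (x + t) - f x) * of_real (dirichlet_kernel n t))
      = (LINT t:{-pi..pi}|lebesgue. f (x + t) * of_real (dirichlet_kernel n t))
        - (LINT t:{-pi..pi}|lebesgue. f x * of_real (dirichlet_kernel n t))"
    unfolding left_diff_distrib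
    by (intro set_integral_diff set_integrable_mult_continuous fx set_integrable_const_circle cD)
  also have "(LINT t:{-pi..pi}|lebesgue. f x * of_real (dirichlet_kernel n t)) = f x * (2 * of_real pi)"
    by (simp only: set_integral_mult_right LINT_dirichlet_kernel)
  finally have "(LINT t:{-pi..pi}|lebesgue. (f (x + t) - f x) * of_real (dirichlet_kernel n t))
      = (LINT t:{-pi..pi}|lebesgue. f (x + t) * of_real (dirichlet_kernel n t)) - f x * (2 * of_real pi)" .
  then show "fourier_partial_sum n f x - f x =
      1 / (2 * of_real pi) * (LINT t:{-pi..pi}|lebesgue. (f (x + t) - f x) * of_real (dirichlet_kernel n t))"
    unfolding S by (simp only: right_diff_distrib) simp
qed

section \<open>Convergence at Lebesgue points\<close>

text \<open>A nonnegative combination of indicators of intervals centred at 0 is a discrete radially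
  decreasing majorant. The mass of \<open>w\<close> is known on exactly such intervals, and the sum
  on the right is half the integral of the majorant.\<close>

lemma LINT_layered_le:
  fixes w k :: "real \<Rightarrow> real" and m \<rho> :: "nat \<Rightarrow> real"
  assumes w: "set_integrable lebesgue {-\<delta>..\<delta>} w" and w0: "\<And>t. 0 \<le> w t"
    and I: "finite I" "\<And>i. i \<in> I \<Longrightarrow> 0 \<le> m i" "\<And>i. i \<in> I \<Longrightarrow> \<rho> i \<le> \<delta>"
    and mass: "\<And>i. i \<in> I \<Longrightarrow> (LINT t:{-\<rho> i..\<rho> i}|lebesgue. w t) \<le> \<epsilon> * \<rho> i"
    and k: "\<And>t. \<bar>t\<bar> \<le> \<delta> \<Longrightarrow> \<bar>k t\<bar> \<le> (\<Sum>i\<in>I. m i * indicator {-\<rho> i..\<rho> i} t)"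
  shows "(LINT t:{-\<delta>..\<delta>}|lebesgue. w t * \<bar>k t\<bar>) \<le> \<epsilon> * (\<Sum>i\<in>I. m i * \<rho> i)"
proof -
  let ?g = "\<lambda>i t. m i * (indicator {-\<rho> i..\<rho> i} t *\<^sub>R w t)"
  have int: "integrable lebesgue (?g i)" if "i \<in> I" for i
  proof -
    have "set_integrable lebesgue {-\<rho> i..\<rho> i} w"
      by (rule set_integrable_subset[OF w]) (use I(3)[OF that] in auto)
    then show ?thesis unfolding set_integrable_def by (rule integrable_mult_right)
  qed
  have "(LINT t:{-\<delta>..\<delta>}|lebesgue. w t * \<bar>k t\<bar>) \<le> (\<integral>t. (\<Sum>i\<in>I. ?g i t) \<partial>lebesgue)"
    unfolding set_lebesgue_integral_def
  proof (rule integral_mono')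
    show "integrable lebesgue (\<lambda>t. \<Sum>i\<in>I. ?g i t)" using int by simp
    show nonneg: "0 \<le> (\<Sum>i\<in>I. ?g i t)" for t
      using I(2) w0 by (intro sum_nonneg) (auto intro!: mult_nonneg_nonneg)
    fix t
    show "indicator {-\<delta>..\<delta>} t *\<^sub>R (w t * \<bar>k t\<bar>) \<le> (\<Sum>i\<in>I. ?g i t)"
    proof (cases "t \<in> {-\<delta>..\<delta>}")
      case True
      then have "w t * \<bar>k t\<bar> \<le> w t * (\<Sum>i\<in>I. m i * indicator {-\<rho> i..\<rho> i} t)"
        by (intro mult_left_mono k w0) auto
      also have "\<dots> = (\<Sum>i\<in>I. ?g i t)" by (simp add: sum_distrib_left mult_ac)
      finally show ?thesis using True by simp
    qed (use nonneg in simp)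
  qed
  also have "\<dots> = (\<Sum>i\<in>I. (\<integral>t. ?g i t \<partial>lebesgue))"
    using int by (rule Bochner_Integration.integral_sum)
  also have "\<dots> = (\<Sum>i\<in>I. m i * (LINT t:{-\<rho> i..\<rho> i}|lebesgue. w t))"
    unfolding set_lebesgue_integral_def by simp
  also have "\<dots> \<le> (\<Sum>i\<in>I. m i * (\<epsilon> * \<rho> i))"
    using I mass by (intro sum_mono mult_left_mono) auto
  also have "\<dots> = \<epsilon> * (\<Sum>i\<in>I. m i * \<rho> i)" by (simp add: sum_distrib_left mult_ac)
  finally show ?thesis .
qed

lemma sum_geometric_le:
  fixes q :: real
  assumes "1 < q"
  shows "(\<Sum>j<J. q ^ j) \<le> q ^ J / (q - 1)" and "(\<Sum>j<J. 1 / q ^ j) \<le> q / (q - 1)"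
proof -
  show "(\<Sum>j<J. q ^ j) \<le> q ^ J / (q - 1)"
    using assms by (simp add: geometric_sum divide_right_mono)
  have "(\<Sum>j<J. (1 / q) ^ j) = (1 - (1 / q) ^ J) / (1 - 1 / q)"
    using assms by (simp add: sum_gp_strict)
  also have "\<dots> \<le> 1 / (1 - 1 / q)" using assms by (intro divide_right_mono) auto
  also have "\<dots> = q / (q - 1)" using assms by (simp add: field_simps)
  finally show "(\<Sum>j<J. 1 / q ^ j) \<le> q / (q - 1)" by (simp add: power_one_over)
qed

text \<open>
  The majorant is cut along the dyadic radii \<open>2\<^sup>j / X\<close>; both of its terms then give geometric sums,
  the first dominated by its largest radius and the second by its smallest.
\<close>

lemma LINT_dyadic_le:
  fixes w k :: "real \<Rightarrow> real"
  assumes c: "0 < c" and C: "0 \<le> C" and X: "0 < X" and \<delta>: "0 < \<delta>" "\<delta> \<le> 1" and \<epsilon>: "0 \<le> \<epsilon>"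
    and w: "set_integrable lebesgue {-\<delta>..\<delta>} w" and w0: "\<And>t. 0 \<le> w t"
    and mass: "\<And>h. 0 < h \<Longrightarrow> h \<le> \<delta> \<Longrightarrow> (LINT t:{-h..h}|lebesgue. w t) \<le> \<epsilon> * h"
    and k1: "\<And>t. \<bar>k t\<bar> \<le> C * X"
    and k2: "\<And>t. 1 \<le> X * \<bar>t\<bar> \<Longrightarrow> \<bar>t\<bar> \<le> \<delta> \<Longrightarrow> \<bar>t\<bar> * \<bar>k t\<bar> \<le> C * (\<bar>t\<bar> powr c + (X * \<bar>t\<bar>) powr - c)"
  shows "(LINT t:{-\<delta>..\<delta>}|lebesgue. w t * \<bar>k t\<bar>)
    \<le> \<epsilon> * (C * (1 + 4 * ((2 powr c)\<^sup>2 / (2 powr c - 1))))"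
proof -
  define q where "q = 2 powr c"
  have q: "1 < q" using c unfolding q_def by (rule gr_one_powr[rotated]) simp
  have qpow: "(2 ^ j) powr c = q ^ j" for j :: nat
    by (simp add: q_def powr_powr mult.commute flip: powr_realpow)
  have "\<exists>j::nat. \<delta> * X < 2 ^ j" by (rule real_arch_pow) simp
  then have "\<exists>j::nat. \<delta> \<le> 2 ^ j / X" using X by (auto simp: le_divide_eq intro: less_imp_le)
  define J where "J = (LEAST j. \<delta> \<le> 2 ^ j / X)"
  have J: "\<delta> \<le> 2 ^ J / X"
    unfolding J_def using \<open>\<exists>j. \<delta> \<le> 2 ^ j / X\<close> by (rule LeastI_ex)
  have J_min: "2 ^ j / X < \<delta>" if "j < J" for j
    using not_less_Least[of j "\<lambda>j. \<delta> \<le> 2 ^ j / X"] that by (auto simp: J_def)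
  \<comment> \<open>The supremum of the majorant on the ring between the radii 2^j / X and 2^(j+1) /
    X: the increasing power is taken at the outer radius, the decreasing factors at the inner one.
    The core, index 0, uses the bound C X.\<close>
  define m where "m i = (case i of 0 \<Rightarrow> C * X
    | Suc j \<Rightarrow> C * ((2 ^ Suc j / X) powr c + (2 ^ j) powr - c) * (X / 2 ^ j))" for i
  \<comment> \<open>The last radius may exceed \<delta>, beyond which nothing is known about the
    mass of \<open>w\<close>.\<close>
  define \<rho> where "\<rho> i = min \<delta> (2 ^ i / X)" for i :: nat
  have m0: "0 \<le> m i" for i using C X by (auto simp: m_def split: nat.splits)
  have \<rho>: "0 < \<rho> i" "\<rho> i \<le> \<delta>" "\<rho> i \<le> 2 ^ i / X" for i using \<delta> X by (auto simp: \<rho>_def)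
  have "(LINT t:{-\<delta>..\<delta>}|lebesgue. w t * \<bar>k t\<bar>) \<le> \<epsilon> * (\<Sum>i\<in>{..J}. m i * \<rho> i)"
  proof (rule LINT_layered_le[OF w w0])
    fix t :: real assume t: "\<bar>t\<bar> \<le> \<delta>"
    define i where "i = (LEAST i. \<bar>t\<bar> \<le> 2 ^ i / X)"
    have tJ: "\<bar>t\<bar> \<le> 2 ^ J / X" using t J by linarith
    then have i: "\<bar>t\<bar> \<le> 2 ^ i / X" and iJ: "i \<le> J"
      unfolding i_def by (auto intro: LeastI Least_le)
    have "t \<in> {-\<rho> i..\<rho> i}" using t i by (auto simp: \<rho>_def)
    then have "m i * indicator {-\<rho> i..\<rho> i} t = m i" by simp
    moreover have "m i * indicator {-\<rho> i..\<rho> i} t \<le> (\<Sum>i\<in>{..J}. m i * indicator {-\<rho> i..\<rho> i} t)"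
      using iJ m0 by (intro member_le_sum) auto
    moreover have "\<bar>k t\<bar> \<le> m i"
    proof (cases i)
      case 0
      then show ?thesis using k1 by (simp add: m_def)
    next
      case (Suc j)
      then have "j < (LEAST i. \<bar>t\<bar> \<le> 2 ^ i / X)" by (simp add: i_def)
      then have j: "2 ^ j / X < \<bar>t\<bar>" using not_less_Least by (metis not_le)
      then have tpos: "0 < \<bar>t\<bar>" using X by (meson divide_pos_pos less_trans zero_less_numeral zero_less_power)
      have Xt: "2 ^ j \<le> X * \<bar>t\<bar>" using j X by (simp add: divide_less_eq mult.commute less_imp_le)
      have "(1::real) \<le> 2 ^ j" by simp
      then have "\<bar>t\<bar> * \<bar>k t\<bar> \<le> C * (\<bar>t\<bar> powr c + (X * \<bar>t\<bar>) powr - c)"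
        using Xt t by (intro k2) linarith
      then have "\<bar>k t\<bar> \<le> C * (\<bar>t\<bar> powr c + (X * \<bar>t\<bar>) powr - c) * (1 / \<bar>t\<bar>)"
        using tpos by (simp add: le_divide_eq mult.commute)
      also have "\<dots> \<le> C * ((2 ^ Suc j / X) powr c + (2 ^ j) powr - c) * (X / 2 ^ j)"
      proof (intro mult_mono add_mono order_refl)
        show "\<bar>t\<bar> powr c \<le> (2 ^ Suc j / X) powr c"
          using i c Suc by (intro powr_mono2) auto
        show "(X * \<bar>t\<bar>) powr - c \<le> (2 ^ j) powr - c"
          using Xt c by (intro powr_mono2') auto
        have "1 / \<bar>t\<bar> \<le> 1 / (2 ^ j / X)"
          using j X tpos by (intro divide_left_mono) auto
        then show "1 / \<bar>t\<bar> \<le> X / 2 ^ j" by simp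
      qed (use C X in auto)
      finally show ?thesis unfolding Suc m_def by simp
    qed
    ultimately show "\<bar>k t\<bar> \<le> (\<Sum>i\<in>{..J}. m i * indicator {-\<rho> i..\<rho> i} t)" by linarith
  qed (use m0 \<rho> mass in auto)
  also have "(\<Sum>i\<in>{..J}. m i * \<rho> i) \<le> C * (1 + 4 * (q\<^sup>2 / (q - 1)))"
  proof -
    have "(\<Sum>i\<in>{..J}. m i * \<rho> i) \<le> (\<Sum>i\<in>{..J}. m i * (2 ^ i / X))"
      using m0 \<rho> by (intro sum_mono mult_left_mono) auto
    also have "\<dots> = m 0 * (2 ^ 0 / X) + (\<Sum>j<J. m (Suc j) * (2 ^ Suc j / X))"
      by (simp only: sum.atMost_shift)
    also have "m 0 * (2 ^ 0 / X) = C" using X by (simp add: m_def)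
    also have "(\<Sum>j<J. m (Suc j) * (2 ^ Suc j / X)) = (\<Sum>j<J. 2 * C * (q / X powr c * q ^ j + 1 / q ^ j))"
    proof (rule sum.cong[OF refl])
      fix j
      have "(2 ^ Suc j / X) powr c = q / X powr c * q ^ j"
        using X by (simp add: powr_divide qpow[of "Suc j"] del: power_Suc) simp
      moreover have "(2 ^ j) powr - c = 1 / q ^ j" by (simp only: powr_minus_divide qpow)
      ultimately have "m (Suc j) = C * (q / X powr c * q ^ j + 1 / q ^ j) * (X / 2 ^ j)"
        by (simp only: m_def nat.case)
      then show "m (Suc j) * (2 ^ Suc j / X) = 2 * C * (q / X powr c * q ^ j + 1 / q ^ j)"
        using X by simp
    qed
    also have "\<dots> = 2 * C * (q / X powr c * (\<Sum>j<J. q ^ j) + (\<Sum>j<J. 1 / q ^ j))"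
      by (simp add: sum_distrib_left sum.distrib distrib_left)
    also have "\<dots> \<le> 2 * C * (q\<^sup>2 / (q - 1) + q\<^sup>2 / (q - 1))"
    proof (intro mult_left_mono add_mono)
      show "q / X powr c * (\<Sum>j<J. q ^ j) \<le> q\<^sup>2 / (q - 1)"
      proof (cases J)
        case 0
        then show ?thesis using q by simp
      next
        case (Suc i)
        \<comment> \<open>Here i = J - 1. Minimality of J together with \<delta> \<le> 1 bounds the
          largest term of the growing series independently of X, although the number of rings
          depends on X.\<close>
        have "2 ^ i / X \<le> 1" using J_min[of i] \<delta> Suc by linarith
        then have "(2 ^ i / X) powr c \<le> 1 powr c"
          using X c by (intro powr_mono2) auto
        then have le: "q ^ i / X powr c \<le> 1" using X by (simp add: powr_divide qpow)
        have "q / X powr c * (\<Sum>j<J. q ^ j) \<le> q / X powr c * (q ^ J / (q - 1))"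
          using q X by (intro mult_left_mono sum_geometric_le) auto
        also have "\<dots> = q\<^sup>2 / (q - 1) * (q ^ i / X powr c)"
          unfolding Suc by (simp add: power2_eq_square mult_ac)
        also have "\<dots> \<le> q\<^sup>2 / (q - 1) * 1" using q le by (intro mult_left_mono) auto
        finally show ?thesis by simp
      qed
      have "(\<Sum>j<J. 1 / q ^ j) \<le> q / (q - 1)" by (rule sum_geometric_le[OF q])
      also have "\<dots> \<le> q\<^sup>2 / (q - 1)"
        using q by (intro divide_right_mono) (auto simp: power2_eq_square)
      finally show "(\<Sum>j<J. 1 / q ^ j) \<le> q\<^sup>2 / (q - 1)" .
    qed (use C in simp)
    finally show ?thesis by (simp add: algebra_simps)
  qed
  finally show ?thesis using \<epsilon> unfolding q_def by (simp add: mult_left_mono)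
qed

lemma LINT_dominated_tendsto_0:
  fixes w :: "real \<Rightarrow> real" and k :: "nat \<Rightarrow> real \<Rightarrow> real"
  assumes w: "set_integrable lebesgue E w" and w0: "\<And>t. 0 \<le> w t"
    and k: "\<And>N. k N \<in> borel_measurable lebesgue"
    and bound: "\<And>N t. 1 \<le> N \<Longrightarrow> t \<in> E \<Longrightarrow> \<bar>k N t\<bar> \<le> B"
    and lim: "AE t in lebesgue. t \<in> E \<longrightarrow> (\<lambda>N. k N t) \<longlonglongrightarrow> 0"
  shows "(\<lambda>N. LINT t:E|lebesgue. w t * \<bar>k N t\<bar>) \<longlonglongrightarrow> 0"
proof -
  let ?w = "\<lambda>t. indicator E t *\<^sub>R w t"
  have wi: "integrable lebesgue ?w" using w by (simp add: set_integrable_def)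
  \<comment> \<open>The index is shifted because the bound is assumed from N = 1 on.\<close>
  have "(\<lambda>N. \<integral>t. ?w t * \<bar>k (Suc N) t\<bar> \<partial>lebesgue) \<longlonglongrightarrow> (\<integral>t. 0 \<partial>(lebesgue :: real measure))"
  proof (rule Bochner_Integration.integral_dominated_convergence[where w = "\<lambda>t. B * ?w t"])
    show "(\<lambda>t. ?w t * \<bar>k (Suc N) t\<bar>) \<in> borel_measurable lebesgue" for N
      using borel_measurable_integrable[OF wi] k[of "Suc N"] by measurable
    show "integrable lebesgue (\<lambda>t. B * ?w t)" using wi by simp
    show "AE t in lebesgue. (\<lambda>N. ?w t * \<bar>k (Suc N) t\<bar>) \<longlonglongrightarrow> 0"
      using lim
    proof eventually_elim
      case (elim t)
      show ?case
      proof (cases "t \<in> E")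
        case True
        with elim have "(\<lambda>N. k N t) \<longlonglongrightarrow> 0" by simp
        from LIMSEQ_Suc[OF this] have "(\<lambda>N. \<bar>k (Suc N) t\<bar>) \<longlonglongrightarrow> 0" by (rule tendsto_rabs_zero)
        then show ?thesis by (rule tendsto_mult_right_zero)
      qed simp
    qed
    show "AE t in lebesgue. norm (?w t * \<bar>k (Suc N) t\<bar>) \<le> B * ?w t" for N
    proof (rule AE_I2)
      fix t
      show "norm (?w t * \<bar>k (Suc N) t\<bar>) \<le> B * ?w t"
        using mult_left_mono[OF bound[of "Suc N" t] w0[of t]] w0[of t]
        by (cases "t \<in> E") (auto simp: abs_mult mult.commute)
    qed
  qed simp
  then have "(\<lambda>N. LINT t:E|lebesgue. w t * \<bar>k (Suc N) t\<bar>) \<longlonglongrightarrow> 0"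
    unfolding set_lebesgue_integral_def by (simp add: mult.assoc)
  then show ?thesis by (rule LIMSEQ_imp_Suc)
qed

section \<open>The kernel of the means\<close>

definition cesaro_kernel :: "real \<Rightarrow> (nat \<Rightarrow> nat) \<Rightarrow> nat \<Rightarrow> real \<Rightarrow> real" where
  "cesaro_kernel \<alpha> a N t =
    (\<Sum>k = 1..N. cesaro_number (\<alpha> - 1) (N - k) * dirichlet_kernel (a k) t) / cesaro_number \<alpha> (N - 1)"

lemma sum_cesaro_weights:
  assumes "0 < \<alpha>" and "1 \<le> N"
  shows "(\<Sum>k = 1..N. cesaro_number (\<alpha> - 1) (N - k)) = cesaro_number \<alpha> (N - 1)"
proof -
  have "(\<Sum>k = 1..N. cesaro_number (\<alpha> - 1) (N - k)) = (\<Sum>i\<le>N - 1. cesaro_number (\<alpha> - 1) i)"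
    by (rule sum.reindex_bij_witness[where i="\<lambda>i. N - i" and j="\<lambda>k. N - k"]) (use assms in auto)
  then show ?thesis using sum_cesaro_number[OF assms(1)] by simp
qed

lemma continuous_cesaro_kernel: "continuous_on S (cesaro_kernel \<alpha> a N)"
  unfolding cesaro_kernel_def divide_inverse
  by (intro continuous_intros continuous_dirichlet_kernel)

lemma cesaro_kernel_abs [simp]: "cesaro_kernel \<alpha> a N \<bar>t\<bar> = cesaro_kernel \<alpha> a N t"
  by (cases "t \<ge> 0") (simp_all add: cesaro_kernel_def)

lemma abs_cesaro_kernel_le:
  assumes \<alpha>: "0 < \<alpha>" and N: "1 \<le> N" and a: "\<And>k. 1 \<le> k \<Longrightarrow> k \<le> N \<Longrightarrow> real (a k) \<le> M"
  shows "\<bar>cesaro_kernel \<alpha> a N t\<bar> \<le> 1 + 2 * M"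
proof -
  have pos: "0 < cesaro_number (\<alpha> - 1) n" "0 < cesaro_number \<alpha> n" for n
    using \<alpha> by (auto intro!: cesaro_number_pos)
  have "\<bar>\<Sum>k = 1..N. cesaro_number (\<alpha> - 1) (N - k) * dirichlet_kernel (a k) t\<bar>
      \<le> (\<Sum>k = 1..N. cesaro_number (\<alpha> - 1) (N - k) * (1 + 2 * M))"
  proof (rule order_trans[OF sum_abs sum_mono])
    fix k assume "k \<in> {1..N}"
    then have "\<bar>dirichlet_kernel (a k) t\<bar> \<le> 1 + 2 * M"
      using abs_dirichlet_kernel_le[of "a k" t] a[of k] by auto
    then show "\<bar>cesaro_number (\<alpha> - 1) (N - k) * dirichlet_kernel (a k) t\<bar>
        \<le> cesaro_number (\<alpha> - 1) (N - k) * (1 + 2 * M)"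
      using pos(1)[of "N - k"] by (simp add: abs_mult)
  qed
  also have "\<dots> = cesaro_number \<alpha> (N - 1) * (1 + 2 * M)"
    unfolding sum_cesaro_weights[OF \<alpha> N, symmetric] by (rule sum_distrib_right[symmetric])
  finally show ?thesis
    using pos(2)[of "N - 1"] by (simp add: cesaro_kernel_def divide_le_eq mult.commute)
qed

text \<open>In sin((a_k + 1/2) t) the half shift is a common factor cis(t / 2) of modulus 1, so
  beyond the factor sin(t / 2) the size of the kernel is governed by the exponential sum.\<close>

lemma cesaro_kernel_sin:
  "cesaro_kernel \<alpha> a N t * sin (t / 2) = Im (cis (t / 2) * cesaro_exp_sum \<alpha> a N t)"
proof -
  have "Im (cis (t / 2) * cesaro_exp_sum \<alpha> a N t)
      = Im (\<Sum>k = 1..N. of_real (cesaro_number (\<alpha> - 1) (N - k)) * (cis (t / 2) * cis (t * real (a k))))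
        / cesaro_number \<alpha> (N - 1)"
    unfolding cesaro_exp_sum_def times_divide_eq_right Im_divide_of_real
    by (simp only: sum_distrib_left mult_ac)
  also have "\<dots> = (\<Sum>k = 1..N. cesaro_number (\<alpha> - 1) (N - k) * sin (t / 2 + real (a k) * t))
        / cesaro_number \<alpha> (N - 1)"
    by (simp add: Im_sum cis_mult mult.commute[of t])
  also have "\<dots> = cesaro_kernel \<alpha> a N t * sin (t / 2)"
    unfolding cesaro_kernel_def dirichlet_kernel_sin[symmetric]
    by (simp add: sum_distrib_right sum_distrib_left mult_ac)
  finally show ?thesis by simp
qed

lemma abs_cesaro_kernel_le_exp_sum:
  assumes "0 < \<bar>t\<bar>" and "\<bar>t\<bar> \<le> pi"
  shows "\<bar>t\<bar> * \<bar>cesaro_kernel \<alpha> a N t\<bar> \<le> pi * norm (cesaro_exp_sum \<alpha> a N \<bar>t\<bar>)"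
proof -
  have s: "\<bar>t\<bar> / pi \<le> sin (\<bar>t\<bar> / 2)" using sin_ge_linear[of "\<bar>t\<bar> / 2"] assms by simp
  have "\<bar>t\<bar> / pi * \<bar>cesaro_kernel \<alpha> a N t\<bar> \<le> sin (\<bar>t\<bar> / 2) * \<bar>cesaro_kernel \<alpha> a N t\<bar>"
    using s by (intro mult_right_mono) auto
  also have "\<dots> \<le> \<bar>cesaro_kernel \<alpha> a N \<bar>t\<bar> * sin (\<bar>t\<bar> / 2)\<bar>"
    by (simp add: abs_mult mult.commute mult_left_mono)
  also have "\<dots> \<le> norm (cis (\<bar>t\<bar> / 2) * cesaro_exp_sum \<alpha> a N \<bar>t\<bar>)"
    unfolding cesaro_kernel_sin by (rule abs_Im_le_cmod)
  also have "\<dots> = norm (cesaro_exp_sum \<alpha> a N \<bar>t\<bar>)" by (simp add: norm_mult)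
  finally show ?thesis by (simp add: divide_le_eq mult.commute)
qed

lemma norm_cesaro_mean_diff_le:
  assumes f: "L1_circle f" and \<alpha>: "0 < \<alpha>" and N: "1 \<le> N"
  shows "norm (cesaro_mean \<alpha> a N f x - f x)
    \<le> 1 / (2 * pi) * (LINT t:{-pi..pi}|lebesgue. norm (f (x + t) - f x) * \<bar>cesaro_kernel \<alpha> a N t\<bar>)"
proof -
  define g where "g t = f (x + t) - f x" for t
  define A where "A = cesaro_number \<alpha> (N - 1)"
  have A: "A > 0" using \<alpha> by (auto simp: A_def intro!: cesaro_number_pos)
  have gi: "set_integrable lebesgue {-pi..pi} g"
    unfolding g_def by (rule fourier_partial_sum_diff_eq(1)[OF f])
  have gD: "set_integrable lebesgue {-pi..pi} (\<lambda>t. g t * of_real (dirichlet_kernel n t))" for n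
    by (intro set_integrable_mult_continuous gi continuous_on_of_real continuous_dirichlet_kernel)
  have gK: "set_integrable lebesgue {-pi..pi} (\<lambda>t. g t * of_real (cesaro_kernel \<alpha> a N t))"
    by (intro set_integrable_mult_continuous gi continuous_on_of_real continuous_cesaro_kernel)
  define c where "c k = complex_of_real (cesaro_number (\<alpha> - 1) (N - k))" for k
  have sum_c: "(\<Sum>k = 1..N. c k) = of_real A"
    unfolding c_def A_def using sum_cesaro_weights[OF \<alpha> N] by (simp flip: of_real_sum)
  have "cesaro_mean \<alpha> a N f x - f x = 1 / of_real A * (\<Sum>k = 1..N. c k * (fourier_partial_sum (a k) f x - f x))"
    using A unfolding right_diff_distrib sum_subtractf sum_distrib_right[symmetric] sum_c
    by (simp add: cesaro_mean_def c_def A_def)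
  also have "(\<Sum>k = 1..N. c k * (fourier_partial_sum (a k) f x - f x))
      = 1 / (2 * of_real pi) * (\<Sum>k = 1..N. LINT t:{-pi..pi}|lebesgue. c k * (g t * of_real (dirichlet_kernel (a k) t)))"
    unfolding fourier_partial_sum_diff_eq(2)[OF f] set_integral_mult_right g_def sum_distrib_left
    by (simp only: mult_ac)
  also have "(\<Sum>k = 1..N. LINT t:{-pi..pi}|lebesgue. c k * (g t * of_real (dirichlet_kernel (a k) t)))
      = (LINT t:{-pi..pi}|lebesgue. \<Sum>k = 1..N. c k * (g t * of_real (dirichlet_kernel (a k) t)))"
    by (intro LINT_sum[symmetric] set_integrable_mult_right gD)
  also have "\<dots> = (LINT t:{-pi..pi}|lebesgue. of_real A * (g t * of_real (cesaro_kernel \<alpha> a N t)))"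
  proof -
    have "(\<Sum>k = 1..N. c k * (g t * of_real (dirichlet_kernel (a k) t))) = of_real A * (g t * of_real (cesaro_kernel \<alpha> a N t))" for t
    proof -
      have "complex_of_real (cesaro_kernel \<alpha> a N t) = (\<Sum>k = 1..N. c k * of_real (dirichlet_kernel (a k) t)) / of_real A"
        by (simp add: cesaro_kernel_def c_def A_def)
      then have "of_real A * (g t * of_real (cesaro_kernel \<alpha> a N t)) = g t * (\<Sum>k = 1..N. c k * of_real (dirichlet_kernel (a k) t))"
        using A by simp
      then show ?thesis by (simp add: sum_distrib_left mult_ac)
    qed
    then show ?thesis by simp
  qed
  also have "\<dots> = of_real A * (LINT t:{-pi..pi}|lebesgue. g t * of_real (cesaro_kernel \<alpha> a N t))"
    by (rule set_integral_mult_right)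
  finally have "cesaro_mean \<alpha> a N f x - f x = 1 / (2 * of_real pi) * (LINT t:{-pi..pi}|lebesgue. g t * of_real (cesaro_kernel \<alpha> a N t))"
    using A by simp
  then have "norm (cesaro_mean \<alpha> a N f x - f x)
      = 1 / (2 * pi) * norm (LINT t:{-pi..pi}|lebesgue. g t * of_real (cesaro_kernel \<alpha> a N t))"
    by (simp add: norm_mult norm_divide)
  also have "\<dots> \<le> 1 / (2 * pi) * (LINT t:{-pi..pi}|lebesgue. norm (g t * of_real (cesaro_kernel \<alpha> a N t)))"
    by (intro mult_left_mono set_integral_norm_bound gK) simp
  finally show ?thesis by (simp add: norm_mult g_def)
qed

text \<open>The coefficients of p take care of k \<ge> K; the finitely many earlier values are
  covered by adding their sum to the constant.\<close>

lemma poly_nat_bound: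
  fixes p :: "real poly" and a :: "nat \<Rightarrow> nat"
  assumes "\<And>k. K \<le> k \<Longrightarrow> real (a k) = poly p (real k)"
  shows "\<exists>L\<ge>0. \<forall>k\<ge>1. real (a k) \<le> L * real k ^ degree p"
proof (intro exI[of _ "(\<Sum>i\<le>degree p. \<bar>coeff p i\<bar>) + (\<Sum>j<K. real (a j))"] conjI allI impI)
  let ?S = "\<Sum>i\<le>degree p. \<bar>coeff p i\<bar>" and ?T = "\<Sum>j<K. real (a j)"
  have ST: "0 \<le> ?S" "0 \<le> ?T" by (auto intro: sum_nonneg)
  then show "0 \<le> ?S + ?T" by simp
  fix k :: nat assume k: "1 \<le> k"
  show "real (a k) \<le> (?S + ?T) * real k ^ degree p"
  proof (cases "K \<le> k")
    case True
    have "real (a k) = (\<Sum>i\<le>degree p. coeff p i * real k ^ i)"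
      using assms[OF True] by (simp add: poly_altdef)
    also have "\<dots> \<le> (\<Sum>i\<le>degree p. \<bar>coeff p i\<bar> * real k ^ degree p)"
    proof (intro sum_mono)
      fix i assume "i \<in> {..degree p}"
      then have "real k ^ i \<le> real k ^ degree p" using k by (intro power_increasing) auto
      then show "coeff p i * real k ^ i \<le> \<bar>coeff p i\<bar> * real k ^ degree p"
        by (intro mult_mono) auto
    qed
    also have "\<dots> = ?S * real k ^ degree p" by (rule sum_distrib_right[symmetric])
    also have "\<dots> \<le> (?S + ?T) * real k ^ degree p" using ST by (intro mult_right_mono) auto
    finally show ?thesis .
  next
    case False
    then have "real (a k) \<le> ?T" by (intro member_le_sum) auto
    also have "\<dots> \<le> (?S + ?T) * 1" using ST by simp
    also have "\<dots> \<le> (?S + ?T) * real k ^ degree p"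
      using ST k by (intro mult_left_mono one_le_power) auto
    finally show ?thesis .
  qed
qed

text \<open>The exceptional frequencies form a countable set. The absolute value appears because the
  even kernel is estimated through the exponential sum at |t|.\<close>

lemma AE_irrational_multiple:
  fixes b :: real
  assumes "b \<noteq> 0"
  shows "AE t in lebesgue. \<bar>t\<bar> * b / (2 * pi) \<notin> \<rat>"
proof -
  have "{t. \<bar>t\<bar> * b / (2 * pi) \<in> \<rat>} \<subseteq> (\<lambda>q. q * (2 * pi) / b) ` \<rat>"
  proof
    fix t assume "t \<in> {t. \<bar>t\<bar> * b / (2 * pi) \<in> \<rat>}"
    then have "t * b / (2 * pi) \<in> \<rat>"
      by (cases "t \<ge> 0") auto
    moreover have "t = (t * b / (2 * pi)) * (2 * pi) / b" using assms by simp
    ultimately show "t \<in> (\<lambda>q. q * (2 * pi) / b) ` \<rat>" by blast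
  qed
  moreover have "countable ((\<lambda>q. q * (2 * pi) / b) ` \<rat>)"
    by (intro countable_image countable_rat)
  ultimately have "countable {t. \<bar>t\<bar> * b / (2 * pi) \<in> \<rat>}" by (rule countable_subset)
  then have "{t. \<bar>t\<bar> * b / (2 * pi) \<in> \<rat>} \<in> null_sets lborel"
    by (rule countable_imp_null_set_lborel)
  from AE_completion[OF AE_not_in[OF this]] show ?thesis by simp
qed

lemma cesaro_mean_polynomial_tendsto:
  fixes p :: "real poly"
  assumes \<alpha>: "0 < \<alpha>" "\<alpha> \<le> 1"
    and deg: "degree p = Suc s" and s: "1 \<le> s" and lc: "coeff p (Suc s) > 0"
    and a: "\<And>k. K \<le> k \<Longrightarrow> real (a k) = poly p (real k)"
    and f: "L1_circle f" and lebesgue: "lebesgue_point f x"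
  shows "(\<lambda>N. cesaro_mean \<alpha> a N f x) \<longlonglongrightarrow> f x"
proof (rule LIMSEQ_I)
  fix \<epsilon> :: real assume \<epsilon>: "0 < \<epsilon>"
  define w where "w t = norm (f (x + t) - f x)" for t
  have w0: "0 \<le> w t" for t by (simp add: w_def)
  have w: "set_integrable lebesgue {-pi..pi} w"
    unfolding w_def by (intro set_integrable_norm fourier_partial_sum_diff_eq(1) f)
  have w_sub: "set_integrable lebesgue S w" if "S \<subseteq> {-pi..pi}" "S \<in> sets lebesgue" for S
    by (rule set_integrable_subset[OF w that(2,1)])
  obtain L where L: "0 \<le> L" "\<And>k. 1 \<le> k \<Longrightarrow> real (a k) \<le> L * real k ^ Suc s"
    using poly_nat_bound[of K a p] a deg by metis
  obtain C0 c where C0: "C0 \<ge> 1" and c: "0 < c"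
    and W: "\<And>N t. 1 \<le> N \<Longrightarrow> 0 < t \<Longrightarrow> 1 \<le> real N ^ Suc s * t \<Longrightarrow>
      norm (cesaro_exp_sum \<alpha> a N t) \<le> C0 * (t powr c + (real N ^ Suc s * t) powr - c)"
    using cesaro_exp_sum_bound[OF \<alpha> deg s lc a] by metis
  \<comment> \<open>One constant for both kernel bounds: 1 + 2 L for the central peak, pi C0 for the
    Weyl bound away from it.\<close>
  define C where "C = 1 + 2 * L + pi * C0"
  have C: "0 \<le> C" using L C0 by (simp add: C_def)
  define M where "M = C * (1 + 4 * ((2 powr c)\<^sup>2 / (2 powr c - 1)))"
  have "1 < 2 powr c" using c by (rule gr_one_powr[rotated]) simp
  then have M: "0 \<le> M" using C by (auto simp: M_def intro!: mult_nonneg_nonneg add_nonneg_nonneg)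
  \<comment> \<open>M depends on C and c only, neither on N nor on the radius, so the smallness
    \<eta> required of the means of \<open>w\<close> can be fixed before the radius
    \<delta>.\<close>
  define \<eta> where "\<eta> = \<epsilon> / (M + 1)"
  have \<eta>: "0 < \<eta>" "\<eta> * M \<le> \<epsilon>" using M \<epsilon> by (auto simp: \<eta>_def field_simps)
  have "\<forall>\<^sub>F h in at_right 0. norm (LINT t:{-h..h}|lebesgue. w t) \<le> \<eta> * norm h"
    using lebesgue \<eta>(1) unfolding lebesgue_point_def w_def by (rule landau_o.smallD)
  then obtain d where d: "0 < d" "\<And>h. 0 < h \<Longrightarrow> h < d \<Longrightarrow> (LINT t:{-h..h}|lebesgue. w t) \<le> \<eta> * h"
    unfolding eventually_at_right[OF zero_less_one] by (fastforce simp: abs_le_iff)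
  \<comment> \<open>Halving d makes \<delta> < d strict, so that the mass bound includes the radius
    h = \<delta> itself; the dyadic estimate asks for \<delta> \<le> 1.\<close>
  define \<delta> where "\<delta> = min 1 (d / 2)"
  have \<delta>: "0 < \<delta>" "\<delta> \<le> 1" "\<delta> < d" using d by (auto simp: \<delta>_def)
  have "\<delta> < pi" using \<delta>(2) pi_gt3 by linarith
  define E where "E = {-pi..pi} - {-\<delta>..\<delta>}"
  have split: "{-pi..pi} = {-\<delta>..\<delta>} \<union> E" "{-\<delta>..\<delta>} \<inter> E = {}"
    using \<open>\<delta> < pi\<close> by (auto simp: E_def)
  have near: "(LINT t:{-\<delta>..\<delta>}|lebesgue. w t * \<bar>cesaro_kernel \<alpha> a N t\<bar>) \<le> \<epsilon>" if N: "1 \<le> N" for N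
  proof -
    have "(LINT t:{-\<delta>..\<delta>}|lebesgue. w t * \<bar>cesaro_kernel \<alpha> a N t\<bar>) \<le> \<eta> * M"
      unfolding M_def
    \<comment> \<open>The reciprocal of N^(s+1) is the width of the central peak: inside it only the
      trivial bound of order N^(s+1) is used, outside it the Weyl bound.\<close>
    proof (rule LINT_dyadic_le[where X = "real N ^ Suc s"])
      show "set_integrable lebesgue {-\<delta>..\<delta>} w" using \<open>\<delta> < pi\<close> by (intro w_sub) auto
      show "(LINT t:{-h..h}|lebesgue. w t) \<le> \<eta> * h" if "0 < h" "h \<le> \<delta>" for h
        using that \<delta> by (intro d) auto
      fix t :: real
      have "\<bar>cesaro_kernel \<alpha> a N t\<bar> \<le> 1 + 2 * (L * real N ^ Suc s)"
      proof (rule abs_cesaro_kernel_le[OF \<alpha>(1) N])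
        fix k assume k: "1 \<le> k" "k \<le> N"
        have "real k ^ Suc s \<le> real N ^ Suc s" using k by (intro power_mono) auto
        then show "real (a k) \<le> L * real N ^ Suc s"
          using L(2)[OF k(1)] mult_left_mono[OF _ L(1)] by (meson order_trans)
      qed
      also have "\<dots> \<le> (1 + 2 * L) * real N ^ Suc s"
        using one_le_power[of "real N" "Suc s"] N by (simp add: distrib_right)
      also have "\<dots> \<le> C * real N ^ Suc s"
        using C0 by (intro mult_right_mono) (auto simp: C_def)
      finally show "\<bar>cesaro_kernel \<alpha> a N t\<bar> \<le> C * real N ^ Suc s" .
      assume t: "1 \<le> real N ^ Suc s * \<bar>t\<bar>" "\<bar>t\<bar> \<le> \<delta>"
      have t0: "0 < \<bar>t\<bar>" using t(1) by (cases "t = 0") auto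
      have "\<bar>t\<bar> * \<bar>cesaro_kernel \<alpha> a N t\<bar> \<le> pi * norm (cesaro_exp_sum \<alpha> a N \<bar>t\<bar>)"
        using t \<open>\<delta> < pi\<close> t0 by (intro abs_cesaro_kernel_le_exp_sum) auto
      also have "\<dots> \<le> pi * (C0 * (\<bar>t\<bar> powr c + (real N ^ Suc s * \<bar>t\<bar>) powr - c))"
        by (intro mult_left_mono W N t t0) simp
      also have "\<dots> = pi * C0 * (\<bar>t\<bar> powr c + (real N ^ Suc s * \<bar>t\<bar>) powr - c)" by simp
      also have "\<dots> \<le> C * (\<bar>t\<bar> powr c + (real N ^ Suc s * \<bar>t\<bar>) powr - c)"
        using L by (intro mult_right_mono) (auto simp: C_def)
      finally show "\<bar>t\<bar> * \<bar>cesaro_kernel \<alpha> a N t\<bar> \<le> C * (\<bar>t\<bar> powr c + (real N ^ Suc s * \<bar>t\<bar>) powr - c)" .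
    qed (use c C \<delta> \<eta> w0 N in auto)
    then show ?thesis using \<eta> by linarith
  qed
  have far: "(\<lambda>N. LINT t:E|lebesgue. w t * \<bar>cesaro_kernel \<alpha> a N t\<bar>) \<longlonglongrightarrow> 0"
  \<comment> \<open>The exponential sum is at most 6, by \<open>norm_cesaro_exp_sum_le\<close> with
    B = 1, and on E the factor pi / |t| is at most pi / \<delta>. As \<delta> stays fixed, this
    constant may depend on it.\<close>
  proof (rule LINT_dominated_tendsto_0[where B = "pi * 6 / \<delta>"])
    show "set_integrable lebesgue E w" by (intro w_sub) (auto simp: E_def)
    show "cesaro_kernel \<alpha> a N \<in> borel_measurable lebesgue" for N
      using borel_measurable_continuous_onI[OF continuous_cesaro_kernel] by (simp add: measurable_completion)
    have E: "\<delta> < \<bar>t\<bar>" "\<bar>t\<bar> \<le> pi" if "t \<in> E" for t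
      using that by (auto simp: E_def)
    have le: "\<bar>cesaro_kernel \<alpha> a N t\<bar> \<le> pi / \<delta> * norm (cesaro_exp_sum \<alpha> a N \<bar>t\<bar>)" if "t \<in> E" for N t
    proof -
      have "\<delta> * \<bar>cesaro_kernel \<alpha> a N t\<bar> \<le> \<bar>t\<bar> * \<bar>cesaro_kernel \<alpha> a N t\<bar>"
        using E[OF that] by (intro mult_right_mono) auto
      also have "\<dots> \<le> pi * norm (cesaro_exp_sum \<alpha> a N \<bar>t\<bar>)"
        using E[OF that] \<delta> by (intro abs_cesaro_kernel_le_exp_sum) auto
      finally show ?thesis using \<delta> by (simp add: le_divide_eq mult.commute)
    qed
    show "\<bar>cesaro_kernel \<alpha> a N t\<bar> \<le> pi * 6 / \<delta>" if N: "1 \<le> N" and t: "t \<in> E" for N t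
    proof -
      have "norm (cesaro_exp_sum \<alpha> a N \<bar>t\<bar>) \<le> 6 * 1 powr \<alpha>"
      proof (rule norm_cesaro_exp_sum_le[OF \<alpha> N])
        show "norm (\<Sum>k = 1..n. cis (\<bar>t\<bar> * real (a k))) \<le> 1 * real N" if "n \<le> N" for n
          using norm_sum[of "\<lambda>k. cis (\<bar>t\<bar> * real (a k))" "{1..n}"] that by simp
      qed (use N in simp)
      then have "pi / \<delta> * norm (cesaro_exp_sum \<alpha> a N \<bar>t\<bar>) \<le> pi / \<delta> * 6"
        using \<delta> by (intro mult_left_mono) auto
      then show ?thesis using le[OF t, of N] by simp
    qed
    have "coeff p (Suc s) \<noteq> 0" using lc by simp
    from AE_irrational_multiple[OF this]
    show "AE t in lebesgue. t \<in> E \<longrightarrow> (\<lambda>N. cesaro_kernel \<alpha> a N t) \<longlonglongrightarrow> 0"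
    proof eventually_elim
      case (elim t)
      have "(\<lambda>N. norm (cesaro_exp_sum \<alpha> a N \<bar>t\<bar>)) \<longlonglongrightarrow> 0"
        using cesaro_exp_sum_tendsto_0[OF \<alpha> deg elim a] by (rule tendsto_norm_zero)
      then have lim: "(\<lambda>N. pi / \<delta> * norm (cesaro_exp_sum \<alpha> a N \<bar>t\<bar>)) \<longlonglongrightarrow> 0"
        by (rule tendsto_mult_right_zero)
      show ?case
      proof
        assume "t \<in> E"
        then show "(\<lambda>N. cesaro_kernel \<alpha> a N t) \<longlonglongrightarrow> 0"
          using le by (intro Lim_null_comparison[OF always_eventually lim]) auto
      qed
    qed
  qed (rule w0)
  have "\<forall>\<^sub>F N in sequentially. (LINT t:E|lebesgue. w t * \<bar>cesaro_kernel \<alpha> a N t\<bar>) < \<epsilon>"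
    using order_tendstoD(2)[OF far \<epsilon>] .
  moreover have "\<forall>\<^sub>F N in sequentially. 1 \<le> (N::nat)" by (rule eventually_ge_at_top)
  ultimately have "\<forall>\<^sub>F N in sequentially. norm (cesaro_mean \<alpha> a N f x - f x) < \<epsilon>"
  proof eventually_elim
    case (elim N)
    have wK: "set_integrable lebesgue {-pi..pi} (\<lambda>t. w t * \<bar>cesaro_kernel \<alpha> a N t\<bar>)"
      by (intro set_integrable_mult_continuous w continuous_on_rabs continuous_cesaro_kernel)
    have "(LINT t:{-pi..pi}|lebesgue. w t * \<bar>cesaro_kernel \<alpha> a N t\<bar>)
        = (LINT t:{-\<delta>..\<delta>}|lebesgue. w t * \<bar>cesaro_kernel \<alpha> a N t\<bar>)
          + (LINT t:E|lebesgue. w t * \<bar>cesaro_kernel \<alpha> a N t\<bar>)"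
      by (subst split(1), rule set_integral_Un[OF split(2)])
         (use \<open>\<delta> < pi\<close> in \<open>auto intro!: set_integrable_subset[OF wK] simp: E_def\<close>)
    \<comment> \<open>The normalisation 1 / (2 pi) turns 2 \<epsilon> into \<epsilon> / pi <
      \<epsilon>.\<close>
    also have "\<dots> < 2 * \<epsilon>" using near[of N] elim by linarith
    finally have less: "(LINT t:{-pi..pi}|lebesgue. w t * \<bar>cesaro_kernel \<alpha> a N t\<bar>) < 2 * \<epsilon>" .
    have "norm (cesaro_mean \<alpha> a N f x - f x)
        \<le> 1 / (2 * pi) * (LINT t:{-pi..pi}|lebesgue. w t * \<bar>cesaro_kernel \<alpha> a N t\<bar>)"
      unfolding w_def using elim by (intro norm_cesaro_mean_diff_le f \<alpha>) auto
    also have "\<dots> < 1 / (2 * pi) * (2 * \<epsilon>)"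
      using less by (intro mult_strict_left_mono) auto
    also have "\<dots> = \<epsilon> / pi" by simp
    also have "\<dots> < \<epsilon>" using \<epsilon> pi_gt3 by (simp add: divide_less_eq)
    finally show ?case .
  qed
  then show "\<exists>N0. \<forall>N\<ge>N0. norm (cesaro_mean \<alpha> a N f x - f x) < \<epsilon>"
    by (simp add: eventually_sequentially)
qed

lemma poly_map_of_rat: "poly (map_poly real_of_rat P) (of_rat y) = of_rat (poly P y)"
  by (induction P) (simp_all add: map_poly_pCons of_rat_add of_rat_mult)

theorem theorem1:
  fixes \<alpha> :: real and P :: "rat poly" and a :: "nat \<Rightarrow> nat"
    and f :: "real \<Rightarrow> complex" and x :: real
  assumes "0 < \<alpha>" and "\<alpha> \<le> 1"
    and "integer_valued P" and "degree P \<ge> 2" and "lead_coeff P > 0"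
    and "strict_mono_on {1..} a" and "\<forall>k\<ge>1. a k > 0"
    and "\<forall>\<^sub>F k in sequentially. of_nat (a k) = poly P (of_nat k)"
    and "L1_circle f" and "lebesgue_point f x"
  shows "(\<lambda>N. cesaro_mean \<alpha> a N f x) \<longlonglongrightarrow> f x"
proof -
  \<comment> \<open>Real coefficients, because the phases are the multiples t p with real t.\<close>
  define p where "p = map_poly real_of_rat P"
  define s where "s = degree P - 1"
  have deg: "degree p = Suc s" and s: "1 \<le> s"
    using \<open>degree P \<ge> 2\<close> by (auto simp: p_def s_def degree_map_poly)
  have lc: "coeff p (Suc s) > 0"
    using \<open>lead_coeff P > 0\<close> \<open>degree P \<ge> 2\<close> by (simp add: p_def s_def coeff_map_poly)
  obtain K where K: "\<And>k. K \<le> k \<Longrightarrow> of_nat (a k) = poly P (of_nat k)"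
    using assms(8) by (auto simp: eventually_sequentially)
  have "real (a k) = poly p (real k)" if "K \<le> k" for k
    using arg_cong[OF K[OF that], of real_of_rat] poly_map_of_rat[of P "of_nat k"] by (simp add: p_def)
  then show ?thesis
    by (rule cesaro_mean_polynomial_tendsto[OF assms(1,2) deg s lc _ assms(9,10)])
qed

end
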